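(* Let $f:[0,1]\to[0,1]$ be a continuous map with positive topological entropy, $h(f)>0$. Then the system $([0,1],f)$ has an uncountable set of DC1-points, i.e. there is an uncountable set $D\subseteq[0,1]$ every element of which is a DC1-point of $f$. Moreover, such an uncountable set $D$ of DC1-points can be chosen perfect.
   Context: Topological entropy $h(f)$ is the usual one (Adler–Konheim–McAndrew). A set is perfect if it is closed and has no isolated points. $[0,1]$ carries its usual metric. Let $(X,d)$ be a compact metric space and $f:X\to X$ continuous; $f^n$ denotes the $n$-th iterate and $B(x_0,\varepsilon)$ the open ball of radius $\varepsilon$ about $x_0$. For $x,y\in X$, $t\in\mathbb{R}$ and $n\ge 1$ let $\xi(x,y,t,n)$ be the number of indices $i\in\{0,1,\dots,n-1\}$ with $d(f^i(x),f^i(y))<t$, and put $$\Psi^n_{xy}(f,t)=\tfrac1n\,\xi(x,y,t,n),\qquad \Psi_{xy}(f,t)=\liminf_{n\to\infty}\Psi^n_{xy}(f,t),\qquad \Psi^*_{xy}(f,t)=\limsup_{n\to\infty}\Psi^n_{xy}(f,t).$$ A pair $x,y$ is a DC1-scrambled pair of $f$ if $\Psi^*_{xy}(f,t)=1$ for all $t>0$ and $\Psi_{xy}(f,t)=0$ for some $t>0$. A set $S\subseteq X$ is DC1-scrambled for $f$ if every pair of distinct points of $S$ is a DC1-scrambled pair of $f$. A point $x_0\in X$ is a DC1-point of $f$ if for every $\varepsilon>0$ there exist an uncountable DC1-scrambled set $S_\varepsilon$ for $f$, a positive integer $n(\varepsilon)$, and a closed set $A_\varepsilon\supseteq S_\varepsilon$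 such that $A_\varepsilon\subseteq f^{n(\varepsilon)}(A_\varepsilon)\subseteq B(x_0,\varepsilon)$. *)

theory Defs
  imports "HOL-Analysis.Analysis"
begin

text \<open>
  Topological entropy in the sense of Adler, Konheim and McAndrew, for a continuous self-map
  \<open>f\<close> of a compact space \<open>T\<close>.
\<close>

definition open_cover :: "'a topology \<Rightarrow> 'a set set \<Rightarrow> bool" where
  "open_cover T \<U> \<longleftrightarrow> (\<forall>U\<in>\<U>. openin T U) \<and> topspace T \<subseteq> \<Union>\<U>"

definition min_subcover_card :: "'a topology \<Rightarrow> 'a set set \<Rightarrow> nat" where
  "min_subcover_card T \<U> = Inf {card \<V> | \<V>. \<V> \<subseteq> \<U> \<and> finite \<V> \<and> topspace T \<subseteq> \<Union>\<V>}"

definition cover_join :: "'a set set \<Rightarrow> 'a set set \<Rightarrow> 'a set set" where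
  "cover_join \<U> \<V> = {U \<inter> V | U V. U \<in> \<U> \<and> V \<in> \<V>}"

definition cover_preimage :: "'a topology \<Rightarrow> ('a \<Rightarrow> 'a) \<Rightarrow> 'a set set \<Rightarrow> 'a set set" where
  "cover_preimage T g \<U> = (\<lambda>U. {x \<in> topspace T. g x \<in> U}) ` \<U>"

text \<open>
  The join of the preimages of \<open>\<U>\<close> under \<open>f\<^sup>0, \<dots>, f\<^sup>n\<^sup>-\<^sup>1\<close>; the one-element cover by the whole space
  is neutral for joins of open covers.
\<close>

primrec iterated_join :: "'a topology \<Rightarrow> ('a \<Rightarrow> 'a) \<Rightarrow> 'a set set \<Rightarrow> nat \<Rightarrow> 'a set set" where
  "iterated_join T f \<U> 0 = {topspace T}"
| "iterated_join T f \<U> (Suc n) =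
     cover_join (iterated_join T f \<U> n) (cover_preimage T (f ^^ n) \<U>)"

text \<open>The limit exists by subadditivity, provided that \<open>T\<close> is nonempty and compact and \<open>f\<close> is continuous.\<close>

definition cover_entropy :: "'a topology \<Rightarrow> ('a \<Rightarrow> 'a) \<Rightarrow> 'a set set \<Rightarrow> real" where
  "cover_entropy T f \<U> =
     lim (\<lambda>n. ln (real (min_subcover_card T (iterated_join T f \<U> n))) / real n)"

definition topological_entropy :: "'a topology \<Rightarrow> ('a \<Rightarrow> 'a) \<Rightarrow> ereal" where
  "topological_entropy T f = (SUP \<U>\<in>{\<U>. open_cover T \<U>}. ereal (cover_entropy T f \<U>))"

text \<open>
  Distributional chaos of type 1. The phase space is a subset \<open>X\<close> of a metric space, and \<open>f\<close> is
  only relevant on \<open>X\<close>, which it is supposed to map into itself.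
\<close>

definition xi :: "('a::metric_space \<Rightarrow> 'a) \<Rightarrow> 'a \<Rightarrow> 'a \<Rightarrow> real \<Rightarrow> nat \<Rightarrow> nat" where
  "xi f x y t n = card {i. i < n \<and> dist ((f ^^ i) x) ((f ^^ i) y) < t}"

definition Psi_n :: "('a::metric_space \<Rightarrow> 'a) \<Rightarrow> 'a \<Rightarrow> 'a \<Rightarrow> real \<Rightarrow> nat \<Rightarrow> real" where
  "Psi_n f x y t n = real (xi f x y t n) / real n"

definition Psi_lower :: "('a::metric_space \<Rightarrow> 'a) \<Rightarrow> 'a \<Rightarrow> 'a \<Rightarrow> real \<Rightarrow> ereal" where
  "Psi_lower f x y t = liminf (\<lambda>n. ereal (Psi_n f x y t n))"

definition Psi_upper :: "('a::metric_space \<Rightarrow> 'a) \<Rightarrow> 'a \<Rightarrow> 'a \<Rightarrow> real \<Rightarrow> ereal" where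
  "Psi_upper f x y t = limsup (\<lambda>n. ereal (Psi_n f x y t n))"

definition DC1_pair :: "('a::metric_space \<Rightarrow> 'a) \<Rightarrow> 'a \<Rightarrow> 'a \<Rightarrow> bool" where
  "DC1_pair f x y \<longleftrightarrow> (\<forall>t>0. Psi_upper f x y t = 1) \<and> (\<exists>t>0. Psi_lower f x y t = 0)"

definition DC1_scrambled :: "'a::metric_space set \<Rightarrow> ('a \<Rightarrow> 'a) \<Rightarrow> 'a set \<Rightarrow> bool" where
  "DC1_scrambled X f S \<longleftrightarrow> S \<subseteq> X \<and> (\<forall>x\<in>S. \<forall>y\<in>S. x \<noteq> y \<longrightarrow> DC1_pair f x y)"

definition DC1_point :: "'a::metric_space set \<Rightarrow> ('a \<Rightarrow> 'a) \<Rightarrow> 'a \<Rightarrow> bool" where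
  "DC1_point X f x0 \<longleftrightarrow> x0 \<in> X \<and>
     (\<forall>\<epsilon>>0. \<exists>S n A. uncountable S \<and> DC1_scrambled X f S \<and> 0 < n \<and>
        closedin (top_of_set X) A \<and> S \<subseteq> A \<and>
        A \<subseteq> (f ^^ n) ` A \<and> (f ^^ n) ` A \<subseteq> ball x0 \<epsilon> \<inter> X)"

definition perfect_set :: "'a::topological_space set \<Rightarrow> bool" where
  "perfect_set D \<longleftrightarrow> closed D \<and> (\<forall>x\<in>D. \<not> x isolated_in D)"

end

theory Submission
  imports Defs
begin

text \<open>
  Split \<open>[0,1]\<close> into \<open>m\<close> cells and follow the itineraries of \<open>g = f\<^sup>k\<close>. The image of an interval meets a
  row of consecutive cells and covers all of them except possibly the two extreme ones. If no
  iterate of \<open>g\<close> has a horseshoe, then the ways to return from a covered cell to itself are so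
  restricted that there are at most \<open>(q + 1)\<^sup>2\<^sup>m 4\<^sup>q\<close> itineraries of length \<open>q\<close>. As \<open>k\<close> is
  arbitrary, this forces the entropy of \<open>f\<close> to vanish. So positive entropy yields disjoint intervals
  \<open>I\<^sub>0, I\<^sub>1 \<subseteq> J\<close> with \<open>f\<^sup>N(I\<^sub>0) = f\<^sup>N(I\<^sub>1) = J\<close>.

  In a horseshoe the cylinders of infinite words are disjoint intervals, so that all but countably
  many of them are points, and such a point has arbitrarily small cylinder neighbourhoods. Each
  cylinder contains a horseshoe of a further iterate of \<open>f\<close>, and a horseshoe contains an uncountable
  DC1-scrambled set: use itineraries made of rapidly growing blocks, alternately equal to
  \<open>0 \<dots> 0 1\<close> for all points (which brings the orbits together) and constant with a symbol that
  depends on the point. This makes all degenerate cylinders DC1-points, and a Cantor set of words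
  avoids the countable exceptional set.
\<close>

section \<open>Compact intervals\<close>

definition segment :: "real set \<Rightarrow> bool" where
  "segment A \<longleftrightarrow> compact A \<and> connected A \<and> A \<noteq> {}"

lemma segment_Icc: "a \<le> b \<Longrightarrow> segment {a..b}"
  by (simp add: segment_def)

lemma segmentE:
  assumes "segment A"
  obtains a b where "a \<le> b" "A = {a..b}"
  using assms unfolding segment_def by (metis atLeastatMost_empty_iff2 connected_compact_interval_1)

lemma segment_mem: "segment A \<Longrightarrow> x \<in> A \<Longrightarrow> y \<in> A \<Longrightarrow> x \<le> z \<Longrightarrow> z \<le> y \<Longrightarrow> z \<in> A"
  by (erule segmentE) auto

lemma segment_image: "segment A \<Longrightarrow> continuous_on A g \<Longrightarrow> segment (g ` A)"
  by (simp add: segment_def compact_continuous_image connected_continuous_image)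

lemma segment_Int: "segment A \<Longrightarrow> segment B \<Longrightarrow> A \<inter> B \<noteq> {} \<Longrightarrow> segment (A \<inter> B)"
  by (elim segmentE) (simp add: segment_def)

text \<open>Let \<open>x'\<close> be the last point of \<open>{x..y}\<close> with value
  \<open>g x\<close> and \<open>y'\<close> the first point after it with value \<open>g y\<close>.
  By the intermediate value theorem, \<open>g\<close> cannot leave \<open>{g x..g y}\<close> in
  between without taking one of these two values again.\<close>

lemma exact_subinterval:
  fixes g :: "real \<Rightarrow> real"
  assumes "x \<le> y" "continuous_on {x..y} g" "g x \<le> g y"
  obtains x' y' where "x \<le> x'" "x' \<le> y'" "y' \<le> y" "g ` {x'..y'} = {g x..g y}"
proof -
  have cl: "closed {z \<in> {u..y}. g z = c}" if "x \<le> u" for u c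
  proof -
    have "continuous_on {u..y} g"
      using assms(2) by (rule continuous_on_subset) (use that in auto)
    then show ?thesis
      by (rule continuous_closed_preimage_constant) auto
  qed
  define R where "R = {z \<in> {x..y}. g z = g x}"
  have "closed R" "x \<in> R" "bdd_above R"
    using cl[of x] assms(1) by (auto simp: R_def intro!: bdd_aboveI[of _ y])
  then have xR: "Sup R \<in> R"
    using closed_contains_Sup[of R] by auto
  have Rle: "z \<le> Sup R" if "z \<in> R" for z
    using that \<open>bdd_above R\<close> by (rule cSup_upper)
  define x' where "x' = Sup R"
  have x': "x \<le> x'" "x' \<le> y" "g x' = g x"
    using xR by (auto simp: R_def x'_def)
  define S where "S = {z \<in> {x'..y}. g z = g y}"
  have "closed S" "y \<in> S" "bdd_below S"
    using cl[of x'] x' by (auto simp: S_def intro!: bdd_belowI[of _ x'])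
  then have yS: "Inf S \<in> S"
    using closed_contains_Inf[of S] by auto
  have Sle: "Inf S \<le> z" if "z \<in> S" for z
    using that \<open>bdd_below S\<close> by (rule cInf_lower)
  define y' where "y' = Inf S"
  have y': "x' \<le> y'" "y' \<le> y" "g y' = g y"
    using yS by (auto simp: S_def y'_def)
  have cont: "continuous_on {u..v} g" if "x' \<le> u" "v \<le> y'" for u v
    using assms(2) by (rule continuous_on_subset) (use that x' y' in auto)
  have "g z \<in> {g x..g y}" if z: "z \<in> {x'..y'}" for z
  proof (rule ccontr)
    assume "g z \<notin> {g x..g y}"
    then consider "g z < g x" | "g z > g y" by fastforce
    then show False
    proof cases
      case 1
      then obtain u where u: "z \<le> u" "u \<le> y'" "g u = g x"
        using IVT'[of g z "g x" y'] cont[of z y'] z y' assms(3) by auto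
      then have "u \<le> x'"
        using Rle[of u] z x' y' by (auto simp: R_def x'_def)
      then have "z = x'" using u z by auto
      then show False using 1 x' by simp
    next
      case 2
      then obtain u where u: "x' \<le> u" "u \<le> z" "g u = g y"
        using IVT'[of g x' "g y" z] cont[of x' z] z x' assms(3) by auto
      then have "y' \<le> u"
        using Sle[of u] z x' y' by (auto simp: S_def y'_def)
      then have "z = y'" using u z by auto
      then show False using 2 y' by simp
    qed
  qed
  moreover have "c \<in> g ` {x'..y'}" if "c \<in> {g x..g y}" for c
    using IVT'[of g x' c y'] cont[of x' y'] that x' y' by fastforce
  ultimately have "g ` {x'..y'} = {g x..g y}" by blast
  then show thesis using that x' y' by blast
qed

text \<open>Choose preimages of the two ends of \<open>B\<close>. If they come in reverse order,
  pass to \<open>- g\<close>.\<close>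

lemma segment_pullback:
  assumes "segment A" "segment B" "continuous_on A g" "B \<subseteq> g ` A"
  obtains C where "C \<subseteq> A" "segment C" "g ` C = B"
proof -
  obtain r s where B: "r \<le> s" "B = {r..s}"
    using assms(2) by (rule segmentE)
  then have "r \<in> g ` A" "s \<in> g ` A"
    using assms(4) by auto
  then obtain x y where xy: "x \<in> A" "y \<in> A" "g x = r" "g y = s"
    by auto
  have sub: "{u..v} \<subseteq> A" if "u \<in> A" "v \<in> A" for u v
    using segment_mem[OF assms(1) that] by auto
  show thesis
  proof (cases "x \<le> y")
    case True
    have "continuous_on {x..y} g"
      using assms(3) sub[OF xy(1,2)] by (rule continuous_on_subset)
    then obtain x' y' where *: "x \<le> x'" "x' \<le> y'" "y' \<le> y" "g ` {x'..y'} = {g x..g y}"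
      using exact_subinterval[OF True, of g] xy B by auto
    have "{x'..y'} \<subseteq> A"
      using * sub[OF xy(1,2)] by fastforce
    then show thesis
      using that * xy B segment_Icc by blast
  next
    case False
    then have le: "y \<le> x" by simp
    have "continuous_on {y..x} g"
      using assms(3) sub[OF xy(2,1)] by (rule continuous_on_subset)
    then have "continuous_on {y..x} (\<lambda>z. - g z)"
      by (rule continuous_on_minus)
    then obtain x' y' where *: "y \<le> x'" "x' \<le> y'" "y' \<le> x"
        "(\<lambda>z. - g z) ` {x'..y'} = {- g y..- g x}"
      using exact_subinterval[OF le, of "\<lambda>z. - g z"] xy B by auto
    have "g ` {x'..y'} = uminus ` ((\<lambda>z. - g z) ` {x'..y'})"
      by (simp add: image_image)
    also have "\<dots> = {g x..g y}"
      unfolding *(4) by simp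
    finally have "g ` {x'..y'} = B"
      using xy B by simp
    moreover have "{x'..y'} \<subseteq> A"
      using * sub[OF xy(2,1)] by fastforce
    ultimately show thesis
      using that * segment_Icc by blast
  qed
qed

text \<open>A segment of length at least \<open>e\<close> meets the grid \<open>e * \<int>\<close>.\<close>

lemma finite_long_segments:
  fixes K :: "'i \<Rightarrow> real set"
  assumes seg: "\<And>i. segment (K i)" and sub: "\<And>i. K i \<subseteq> {0..1}"
    and disj: "\<And>i j. i \<noteq> j \<Longrightarrow> K i \<inter> K j = {}" and "e > 0"
  shows "finite {i. \<exists>x\<in>K i. \<exists>y\<in>K i. dist x y \<ge> e}"
proof -
  let ?L = "{i. \<exists>x\<in>K i. \<exists>y\<in>K i. dist x y \<ge> e}"
  have "\<exists>c::int. e * c \<in> K i" if i: "i \<in> ?L" for i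
  proof -
    obtain x y where xy: "x \<in> K i" "y \<in> K i" "x + e \<le> y"
      using i unfolding dist_real_def by (auto simp: abs_if split: if_splits)
    have "x / e \<le> ceiling (x / e)" "ceiling (x / e) < x / e + 1" by linarith+
    then have "e * (x / e) \<le> e * ceiling (x / e)" "e * ceiling (x / e) < e * (x / e + 1)"
      using \<open>e > 0\<close> by (simp_all only: mult_le_cancel_left_pos mult_less_cancel_left_pos)
    then have "x \<le> e * ceiling (x / e)" "e * ceiling (x / e) < x + e"
      using \<open>e > 0\<close> by (simp_all add: distrib_left)
    then have "x \<le> e * ceiling (x / e)" "e * ceiling (x / e) \<le> y"
      using xy(3) by linarith+
    then show ?thesis using segment_mem[OF seg xy(1,2)] by blast
  qed
  then have "\<forall>i\<in>?L. \<exists>c::int. e * c \<in> K i"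
    by blast
  from bchoice[OF this] obtain c :: "'i \<Rightarrow> int" where c: "\<And>i. i \<in> ?L \<Longrightarrow> e * c i \<in> K i"
    by blast
  have "inj_on c ?L"
  proof (rule inj_onI)
    fix i j assume "i \<in> ?L" "j \<in> ?L" "c i = c j"
    then have "K i \<inter> K j \<noteq> {}"
      using c[of i] c[of j] by auto
    then show "i = j" using disj by blast
  qed
  moreover have "c ` ?L \<subseteq> {0..ceiling (1 / e)}"
  proof (rule image_subsetI)
    fix i assume "i \<in> ?L"
    then have "e * c i \<in> {0..1}" using c sub by blast
    then have "0 \<le> e * c i" "e * c i \<le> 1" by auto
    then have "0 \<le> c i" "c i \<le> 1 / e"
      using \<open>e > 0\<close> by (auto simp: zero_le_mult_iff field_simps)
    then show "c i \<in> {0..ceiling (1 / e)}" by (simp add: le_ceiling_iff)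
  qed
  ultimately show ?thesis
    using finite_subset[of "c ` ?L"] finite_imageD by blast
qed

lemma countable_nondegenerate_segments:
  fixes K :: "'i \<Rightarrow> real set"
  assumes seg: "\<And>i. segment (K i)"
    and disj: "\<And>i j. i \<noteq> j \<Longrightarrow> K i \<inter> K j = {}"
  shows "countable {i. \<exists>x\<in>K i. \<exists>y\<in>K i. x \<noteq> y}"
proof -
  let ?L = "{i. \<exists>x\<in>K i. \<exists>y\<in>K i. x \<noteq> y}"
  have "\<exists>c::rat. of_rat c \<in> K i" if i: "i \<in> ?L" for i
  proof -
    obtain x y where xy: "x \<in> K i" "y \<in> K i" "x < y"
      using i by (auto simp: neq_iff)
    obtain q where "x < of_rat q" "of_rat q < y"
      using of_rat_dense[OF xy(3)] by auto
    then show ?thesis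
      using segment_mem[OF seg xy(1,2)] by (meson less_imp_le)
  qed
  then have "\<forall>i\<in>?L. \<exists>c::rat. of_rat (c) \<in> K i"
    by blast
  from bchoice[OF this] obtain c :: "'i \<Rightarrow> rat" where c: "\<And>i. i \<in> ?L \<Longrightarrow> of_rat (c i) \<in> K i"
    by blast
  have "inj_on c ?L"
  proof (rule inj_onI)
    fix i j assume "i \<in> ?L" "j \<in> ?L" "c i = c j"
    then have "K i \<inter> K j \<noteq> {}"
      using c[of i] c[of j] by auto
    then show "i = j" using disj by blast
  qed
  then show ?thesis
    by (rule countable_image_inj_on[OF countableI_type])
qed

section \<open>Iterates\<close>

lemma funpow_maps_to: "f ` X \<subseteq> X \<Longrightarrow> x \<in> X \<Longrightarrow> (f ^^ n) x \<in> X"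
  by (induction n) auto

lemma continuous_on_funpow:
  assumes "continuous_on X f" "f ` X \<subseteq> X"
  shows "continuous_on X (f ^^ n)"
proof (induction n)
  case 0
  show ?case by (simp add: id_def)
next
  case (Suc n)
  have "continuous_on ((f ^^ n) ` X) f"
    using assms(1) by (rule continuous_on_subset) (use funpow_maps_to[OF assms(2)] in auto)
  then show ?case
    using continuous_on_compose[OF Suc] by simp
qed

text \<open>The minimum of finitely many moduli of continuity. It will link the multiples of
  \<open>N\<close>, where itineraries are known, with the times in between.\<close>

lemma funpow_uniformly_small:
  fixes f :: "'a::metric_space \<Rightarrow> 'a"
  assumes "compact X" "continuous_on X f" "f ` X \<subseteq> X" "e > 0"
  obtains t where "t > 0"
    "\<And>s u v. s \<le> N \<Longrightarrow> u \<in> X \<Longrightarrow> v \<in> X \<Longrightarrow> dist u v < t \<Longrightarrow> dist ((f ^^ s) u) ((f ^^ s) v) < e"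
proof -
  have "\<forall>s. \<exists>t>0. \<forall>u\<in>X. \<forall>v\<in>X. dist u v < t \<longrightarrow> dist ((f ^^ s) u) ((f ^^ s) v) < e"
  proof
    fix s
    have "uniformly_continuous_on X (f ^^ s)"
      using continuous_on_funpow[OF assms(2,3)] assms(1) by (rule compact_uniformly_continuous)
    then show "\<exists>t>0. \<forall>u\<in>X. \<forall>v\<in>X. dist u v < t \<longrightarrow> dist ((f ^^ s) u) ((f ^^ s) v) < e"
      unfolding uniformly_continuous_on_def using \<open>e > 0\<close> by (metis dist_commute)
  qed
  then obtain t where t: "\<And>s. t s > 0"
    "\<And>s u v. u \<in> X \<Longrightarrow> v \<in> X \<Longrightarrow> dist u v < t s \<Longrightarrow> dist ((f ^^ s) u) ((f ^^ s) v) < e"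
    by metis
  show thesis
  proof (rule that[of "Min (t ` {..N})"])
    show "Min (t ` {..N}) > 0" using t(1) by (subst Min_gr_iff) auto
    show "dist ((f ^^ s) u) ((f ^^ s) v) < e"
      if "s \<le> N" "u \<in> X" "v \<in> X" "dist u v < Min (t ` {..N})" for s u v
      using t(2)[of u v s] that by (subst (asm) Min_gr_iff) auto
  qed
qed

section \<open>Itineraries of an interval map\<close>

text \<open>Closed cells keep all sets compact. In return, neighbours share an endpoint, and only
  cells whose indices differ by at least two are disjoint.\<close>

definition cell :: "nat \<Rightarrow> nat \<Rightarrow> real set" where
  "cell m b = {real b / real m..(real b + 1) / real m}"

lemma segment_cell: "0 < m \<Longrightarrow> segment (cell m b)"
  unfolding cell_def by (intro segment_Icc divide_right_mono) auto

lemma cell_subset: "b < m \<Longrightarrow> cell m b \<subseteq> {0..1}"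
  by (auto simp: cell_def field_simps)

lemma cells_cover:
  assumes "0 < m" "x \<in> {0..1}"
  obtains b where "b < m" "x \<in> cell m b"
proof (cases "x = 1")
  case True
  then show thesis
    using that[of "m - 1"] assms(1) by (auto simp: cell_def field_simps of_nat_diff)
next
  case False
  let ?b = "nat \<lfloor>real m * x\<rfloor>"
  have "0 \<le> real m * x" "real m * x < real m"
    using assms False by auto
  then have "real ?b \<le> real m * x" "real m * x \<le> real ?b + 1" "real ?b < real m"
    by linarith+
  then show thesis
    using that[of ?b] assms(1) by (simp add: cell_def field_simps)
qed

lemma cell_disjoint: "0 < m \<Longrightarrow> b + 1 < c \<Longrightarrow> cell m b \<inter> cell m c = {}"
  by (auto simp: cell_def field_simps)

text \<open>
  The set of values at time \<open>i\<close> of the orbits which pass through the cells \<open>w 0, \<dots>, w (i - 1)\<close> at the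
  times before. It is connected although the set of these starting points need not be.
\<close>

fun reach :: "(real \<Rightarrow> real) \<Rightarrow> nat \<Rightarrow> (nat \<Rightarrow> nat) \<Rightarrow> nat \<Rightarrow> real set" where
  "reach g m w 0 = {0..1}"
| "reach g m w (Suc i) = g ` (reach g m w i \<inter> cell m (w i))"

definition follows :: "(real \<Rightarrow> real) \<Rightarrow> nat \<Rightarrow> (nat \<Rightarrow> nat) \<Rightarrow> nat \<Rightarrow> bool" where
  "follows g m w q \<longleftrightarrow> (\<forall>i<q. w i < m \<and> reach g m w i \<inter> cell m (w i) \<noteq> {})"

definition full_at :: "(real \<Rightarrow> real) \<Rightarrow> nat \<Rightarrow> (nat \<Rightarrow> nat) \<Rightarrow> nat \<Rightarrow> bool" where
  "full_at g m w i \<longleftrightarrow> cell m (w i) \<subseteq> reach g m w i"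

lemma reach_cong: "(\<And>j. j < i \<Longrightarrow> w j = w' j) \<Longrightarrow> reach g m w i = reach g m w' i"
  by (induction i) auto

locale interval_map =
  fixes g :: "real \<Rightarrow> real" and m :: nat
  assumes cont: "continuous_on {0..1} g" and self_map: "g ` {0..1} \<subseteq> {0..1}" and m_pos: "0 < m"
begin

lemma segment_reach:
  assumes "follows g m w q" "i \<le> q"
  shows "segment (reach g m w i) \<and> reach g m w i \<subseteq> {0..1}"
  using assms(2)
proof (induction i)
  case 0
  then show ?case by (simp add: segment_Icc)
next
  case (Suc i)
  let ?R = "reach g m w i \<inter> cell m (w i)"
  have *: "segment ?R" "?R \<subseteq> {0..1}"
    using Suc assms(1) segment_cell[OF m_pos] by (auto simp: follows_def intro!: segment_Int)
  have "segment (g ` ?R)"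
    using *(1) continuous_on_subset[OF cont *(2)] by (rule segment_image)
  then show ?case using *(2) self_map by auto
qed

text \<open>\<open>reach\<close> is an interval, so with points of a lower and of a higher cell it
  contains all that lies between.\<close>

lemma full_between:
  assumes w: "follows g m w q" and i: "i < q" and b: "b < w i" "reach g m w i \<inter> cell m b \<noteq> {}"
    and c: "w i < c" "reach g m w i \<inter> cell m c \<noteq> {}"
  shows "full_at g m w i"
proof -
  have seg: "segment (reach g m w i)" using segment_reach[OF w] i by simp
  obtain x y where x: "x \<in> reach g m w i" "x \<in> cell m b" and y: "y \<in> reach g m w i" "y \<in> cell m c"
    using b(2) c(2) by auto
  have "real b + 1 \<le> real (w i)" "real (w i) + 1 \<le> real c" using b(1) c(1) by linarith+
  then have "(real b + 1) / real m \<le> real (w i) / real m" "(real (w i) + 1) / real m \<le> real c / real m"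
    using m_pos by (auto intro!: divide_right_mono)
  then have "x \<le> real (w i) / real m" "(real (w i) + 1) / real m \<le> y"
    using x(2) y(2) unfolding cell_def by auto
  then have "cell m (w i) \<subseteq> {x..y}" unfolding cell_def by auto
  moreover have "{x..y} \<subseteq> reach g m w i" using segment_mem[OF seg x(1) y(1)] by auto
  ultimately show ?thesis by (auto simp: full_at_def)
qed

text \<open>Pull \<open>T\<close> back one step at a time, always within the reachable part of the
  current cell; thus the intermediate images stay in the prescribed cells.\<close>

lemma pull_back_along:
  assumes w: "follows g m w q" and "s + d < q" "segment T" "T \<subseteq> reach g m w (s + d) \<inter> cell m (w (s + d))"
  shows "\<exists>C. segment C \<and> C \<subseteq> cell m (w s) \<and> (g ^^ d) ` C = T \<and>
           (\<forall>j\<le>d. (g ^^ j) ` C \<subseteq> cell m (w (s + j)))"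
  using assms(2-)
proof (induction d arbitrary: T)
  case 0
  then show ?case by (intro exI[of _ T]) simp
next
  case (Suc d)
  let ?R = "reach g m w (s + d) \<inter> cell m (w (s + d))"
  have R: "segment ?R" "?R \<subseteq> {0..1}"
    using Suc.prems(1) segment_reach[OF w, of "s + d"] w segment_cell[OF m_pos]
    by (auto simp: follows_def intro!: segment_Int)
  have "T \<subseteq> g ` ?R" using Suc.prems(3) by simp
  then obtain T' where T': "T' \<subseteq> ?R" "segment T'" "g ` T' = T"
    using segment_pullback[OF R(1) Suc.prems(2) continuous_on_subset[OF cont R(2)]] by metis
  have "s + d < q" using Suc.prems(1) by simp
  then obtain C where C: "segment C" "C \<subseteq> cell m (w s)" "(g ^^ d) ` C = T'"
      "\<forall>j\<le>d. (g ^^ j) ` C \<subseteq> cell m (w (s + j))"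
    using Suc.IH[OF _ T'(2,1)] by blast
  have im: "(g ^^ Suc d) ` C = T"
    unfolding T'(3)[symmetric] C(3)[symmetric] image_comp by simp
  have "(g ^^ j) ` C \<subseteq> cell m (w (s + j))" if "j \<le> Suc d" for j
  proof (cases "j = Suc d")
    case True
    then show ?thesis using im Suc.prems(3) by simp
  next
    case False
    then show ?thesis using C(4) that by simp
  qed
  then show ?case using C im by blast
qed

text \<open>A return between two full times in the same cell yields one branch of a potential
  horseshoe over this cell.\<close>

lemma return_interval:
  assumes w: "follows g m w q" and "s < e" "e < q" "full_at g m w s" "full_at g m w e" "w s = w e"
  obtains C where "segment C" "C \<subseteq> cell m (w s)" "(g ^^ (e - s)) ` C = cell m (w s)"
    "\<And>i. s \<le> i \<Longrightarrow> i \<le> e \<Longrightarrow> (g ^^ (i - s)) ` C \<subseteq> cell m (w i)"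
proof -
  have "s + (e - s) < q" "cell m (w e) \<subseteq> reach g m w (s + (e - s)) \<inter> cell m (w (s + (e - s)))"
    using assms by (auto simp: full_at_def)
  from pull_back_along[OF w this(1) segment_cell[OF m_pos] this(2)]
  obtain C where C: "segment C" "C \<subseteq> cell m (w s)" "(g ^^ (e - s)) ` C = cell m (w e)"
      "\<forall>j\<le>e - s. (g ^^ j) ` C \<subseteq> cell m (w (s + j))"
    by blast
  have "(g ^^ (i - s)) ` C \<subseteq> cell m (w i)" if "s \<le> i" "i \<le> e" for i
    using C(4)[rule_format, of "i - s"] that by simp
  then show thesis using that C assms(6) by metis
qed

section \<open>Counting itineraries without horseshoes\<close>

definition has_horseshoe :: bool where
  "has_horseshoe \<longleftrightarrow> (\<exists>J A B n. 0 < n \<and> segment J \<and> J \<subseteq> {0..1} \<and> segment A \<and> segment B \<and>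
     A \<subseteq> J \<and> B \<subseteq> J \<and> A \<inter> B = {} \<and> (g ^^ n) ` A = J \<and> (g ^^ n) ` B = J)"

text \<open>If \<open>w i\<close> exceeds \<open>w' i\<close> by more than one, the branches from
  \<open>return_interval\<close> pass through disjoint cells at time \<open>i\<close>. Hence they
  are disjoint and form a horseshoe over \<open>cell m b\<close>.\<close>

lemma return_words_close:
  assumes no: "\<not> has_horseshoe"
    and w: "follows g m w q" "full_at g m w s" "full_at g m w e"
    and w': "follows g m w' q" "full_at g m w' s" "full_at g m w' e"
    and b: "w s = b" "w e = b" "w' s = b" "w' e = b"
    and i: "s < e" "e < q" "s \<le> i" "i \<le> e"
  shows "w i \<le> w' i + 1"
proof (rule ccontr)
  assume far: "\<not> w i \<le> w' i + 1"
  obtain C where C: "segment C" "C \<subseteq> cell m b" "(g ^^ (e - s)) ` C = cell m b"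
      "(g ^^ (i - s)) ` C \<subseteq> cell m (w i)"
    using return_interval[OF w(1) i(1,2) w(2,3)] b i by metis
  obtain C' where C': "segment C'" "C' \<subseteq> cell m b" "(g ^^ (e - s)) ` C' = cell m b"
      "(g ^^ (i - s)) ` C' \<subseteq> cell m (w' i)"
    using return_interval[OF w'(1) i(1,2) w'(2,3)] b i by metis
  have "cell m (w' i) \<inter> cell m (w i) = {}"
    using far by (intro cell_disjoint m_pos) simp
  then have "C \<inter> C' = {}" using C(4) C'(4) by blast
  moreover have "b < m" using w(1) b i by (auto simp: follows_def)
  ultimately have has_horseshoe
    unfolding has_horseshoe_def using C C' i segment_cell[OF m_pos] cell_subset
    by (intro exI[of _ "cell m b"] exI[of _ C] exI[of _ C'] exI[of _ "e - s"]) simp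
  then show False using no by simp
qed

text \<open>
  Without horseshoes an itinerary is determined by the first and the last time at which each cell
  is full, together with one of four symbols per step: is the current cell the lowest or the
  highest one that can be reached, and otherwise (when it is full) what is its parity? Indeed, two
  itineraries that are full at \<open>b\<close> at the same first and last time differ by at most one in between.
\<close>

definition hits :: "(nat \<Rightarrow> nat) \<Rightarrow> nat \<Rightarrow> nat set" where
  "hits w i = {b. b < m \<and> reach g m w i \<inter> cell m b \<noteq> {}}"

definition symbol :: "(nat \<Rightarrow> nat) \<Rightarrow> nat \<Rightarrow> nat" where
  "symbol w i = (if w i = Min (hits w i) then 0 else if w i = Max (hits w i) then 1 else 2 + w i mod 2)"

definition visits :: "nat \<Rightarrow> (nat \<Rightarrow> nat) \<Rightarrow> nat \<Rightarrow> nat set" where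
  "visits q w b = {i. i < q \<and> w i = b \<and> full_at g m w i}"

text \<open>Visits happen before time \<open>q\<close>, so the default \<open>q\<close> marks a cell
  without visits.\<close>

definition first_visit :: "nat \<Rightarrow> (nat \<Rightarrow> nat) \<Rightarrow> nat \<Rightarrow> nat" where
  "first_visit q w b = (if visits q w b = {} then q else Min (visits q w b))"

definition last_visit :: "nat \<Rightarrow> (nat \<Rightarrow> nat) \<Rightarrow> nat \<Rightarrow> nat" where
  "last_visit q w b = (if visits q w b = {} then q else Max (visits q w b))"

lemma finite_visits: "finite (visits q w b)"
  by (simp add: visits_def)

lemma visit_bounds:
  assumes "i \<in> visits q w b"
  shows "first_visit q w b \<in> visits q w b" "last_visit q w b \<in> visits q w b"
    "first_visit q w b \<le> i" "i \<le> last_visit q w b"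
  using assms finite_visits[of q w b] Min_in[of "visits q w b"] Max_in[of "visits q w b"]
  by (auto simp: first_visit_def last_visit_def)

lemma visit_times_le: "first_visit q w b \<le> q" "last_visit q w b \<le> q"
proof -
  have "i \<le> q" if "i \<in> visits q w b" for i
    using that by (simp add: visits_def)
  then show "first_visit q w b \<le> q" "last_visit q w b \<le> q"
    using finite_visits[of q w b] by (simp_all add: first_visit_def last_visit_def Min_in Max_in)
qed

lemma visits_of_first_last:
  "first_visit q w b < q \<Longrightarrow> first_visit q w b \<in> visits q w b"
  "last_visit q w b < q \<Longrightarrow> last_visit q w b \<in> visits q w b"
  using finite_visits[of q w b] Min_in[of "visits q w b"] Max_in[of "visits q w b"]
  by (auto simp: first_visit_def last_visit_def split: if_splits)

lemma close_same_parity: "a \<le> b + 1 \<Longrightarrow> b \<le> a + 1 \<Longrightarrow> a mod 2 = b mod 2 \<Longrightarrow> a = b" for a b :: nat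
  by presburger

lemma itinerary_determined:
  assumes no: "\<not> has_horseshoe"
    and w: "follows g m w q" and w': "follows g m w' q"
    and first: "\<And>b. b < m \<Longrightarrow> first_visit q w b = first_visit q w' b"
    and last: "\<And>b. b < m \<Longrightarrow> last_visit q w b = last_visit q w' b"
    and sym: "\<And>i. i < q \<Longrightarrow> symbol w i = symbol w' i"
    and "i < q"
  shows "w i = w' i"
  using \<open>i < q\<close>
proof (induction i rule: less_induct)
  case (less i)
  then have "reach g m w i = reach g m w' i"
    by (intro reach_cong) auto
  then have H: "hits w i = hits w' i" by (simp add: hits_def)
  have hit: "w i \<in> hits w i" "w' i \<in> hits w i"
  proof -
    show "w i \<in> hits w i" using w less.prems by (simp add: follows_def hits_def)
    show "w' i \<in> hits w i" unfolding H using w' less.prems by (simp add: follows_def hits_def)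
  qed
  have fin: "finite (hits w i)" by (simp add: hits_def)
  show ?case
  \<comment> \<open>Symbols 0 and 1 name an extreme cell of the common set of hits. For the others
    the current cell lies strictly between the extremes and is therefore full.\<close>
  proof (cases "symbol w i < 2")
    case True
    then show ?thesis
      using sym[OF less.prems] by (auto simp: symbol_def H split: if_splits)
  next
    case False
    then have ne: "w i \<noteq> Min (hits w i)" "w i \<noteq> Max (hits w i)" and par: "w i mod 2 = w' i mod 2"
      using sym[OF less.prems] by (auto simp: symbol_def H split: if_splits)
    have "Min (hits w i) < w i" "w i < Max (hits w i)"
      using ne hit(1) fin by (auto simp: le_neq_trans)
    moreover have "Min (hits w i) \<in> hits w i" "Max (hits w i) \<in> hits w i"
      using fin hit(1) by (auto intro: Min_in Max_in)
    ultimately have "full_at g m w i"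
      using full_between[OF w less.prems] by (auto simp: hits_def)
    define b where "b = w i"
    have bm: "b < m" using w less.prems by (auto simp: follows_def b_def)
    have i: "i \<in> visits q w b"
      using \<open>full_at g m w i\<close> less.prems by (simp add: visits_def b_def)
    define s where "s = first_visit q w b"
    define e where "e = last_visit q w b"
    have se: "s \<in> visits q w b" "e \<in> visits q w b" "s \<le> i" "i \<le> e"
      using visit_bounds[OF i] by (auto simp: s_def e_def)
    have "s < q" "e < q" using se by (auto simp: visits_def)
    \<comment> \<open>Being below \<open>q\<close>, the times \<open>s\<close> and \<open>e\<close>
      are not defaults, so they are visits of \<open>w'\<close> as well.\<close>
    then have se': "s \<in> visits q w' b" "e \<in> visits q w' b"
      using visits_of_first_last[of q w' b] first[OF bm] last[OF bm] by (auto simp: s_def e_def)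
    show ?thesis
    proof (cases "s = e")
      case True
      then have "i = s" using se by simp
      then show ?thesis using se' by (simp add: visits_def b_def)
    next
      case False
      then have "s < e" using se by simp
      have at: "full_at g m w s" "full_at g m w e" "w s = b" "w e = b"
          "full_at g m w' s" "full_at g m w' e" "w' s = b" "w' e = b"
        using se se' by (simp_all add: visits_def)
      have "w i \<le> w' i + 1"
        by (rule return_words_close[OF no w at(1,2) w' at(5,6,3,4,7,8) \<open>s < e\<close> \<open>e < q\<close> se(3,4)])
      moreover have "w' i \<le> w i + 1"
        by (rule return_words_close[OF no w' at(5,6) w at(1,2,7,8,3,4) \<open>s < e\<close> \<open>e < q\<close> se(3,4)])
      ultimately show ?thesis using par by (rule close_same_parity)
    qed
  qed
qed

definition itineraries :: "nat \<Rightarrow> nat list set" where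
  "itineraries q = {ws. length ws = q \<and> follows g m ((!) ws) q}"

lemma finite_itineraries: "finite (itineraries q)"
proof -
  have "itineraries q \<subseteq> {ws. set ws \<subseteq> {..<m} \<and> length ws = q}"
    by (auto simp: itineraries_def follows_def in_set_conv_nth)
  then show ?thesis by (rule finite_subset) (simp add: finite_lists_length_eq)
qed

text \<open>The code consists of two lists of \<open>m\<close> times in \<open>{0..q}\<close>,
  default included, and of \<open>q\<close> symbols out of four; it is injective by
  \<open>itinerary_determined\<close>.\<close>

lemma card_itineraries:
  assumes "\<not> has_horseshoe"
  shows "card (itineraries q) \<le> (q + 1) ^ (2 * m) * 4 ^ q"
proof -
  let ?c = "\<lambda>ws. (map (first_visit q ((!) ws)) [0..<m], map (last_visit q ((!) ws)) [0..<m],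
    map (symbol ((!) ws)) [0..<q])"
  let ?L = "\<lambda>k l. {xs. set xs \<subseteq> {..<k::nat} \<and> length xs = (l::nat)}"
  have "inj_on ?c (itineraries q)"
  proof (rule inj_onI)
    fix ws ws' assume ws: "ws \<in> itineraries q" "ws' \<in> itineraries q" and eq: "?c ws = ?c ws'"
    show "ws = ws'"
    proof (rule nth_equalityI)
      show "length ws = length ws'" using ws by (simp add: itineraries_def)
      fix i assume "i < length ws"
      then show "ws ! i = ws' ! i"
        using ws eq itinerary_determined[OF assms, of "(!) ws" q "(!) ws'" i]
        by (auto simp: itineraries_def)
    qed
  qed
  moreover have "?c ` itineraries q \<subseteq> ?L (q + 1) m \<times> ?L (q + 1) m \<times> ?L 4 q"
    by (auto simp: visit_times_le less_Suc_eq_le symbol_def split: if_splits)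
  moreover have "finite (?L (q + 1) m \<times> ?L (q + 1) m \<times> ?L 4 q)"
    by (intro finite_cartesian_product finite_lists_length_eq) simp_all
  ultimately have "card (itineraries q) \<le> card (?L (q + 1) m \<times> ?L (q + 1) m \<times> ?L 4 q)"
    by (rule card_inj_on_le)
  also have "\<dots> = (q + 1) ^ (2 * m) * 4 ^ q"
    by (simp only: card_cartesian_product card_lists_length_eq finite_lessThan card_lessThan
        mult_2 power_add mult.assoc)
  finally show ?thesis .
qed

lemma orbit_has_itinerary:
  assumes "x \<in> {0..1}"
  obtains ws where "ws \<in> itineraries q" "\<And>i. i < q \<Longrightarrow> (g ^^ i) x \<in> cell m (ws ! i)"
proof -
  have "\<forall>i. \<exists>b. b < m \<and> (g ^^ i) x \<in> cell m b"
    using cells_cover[OF m_pos funpow_maps_to[OF self_map assms]] by metis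
  then obtain w where w: "\<And>i. w i < m" "\<And>i. (g ^^ i) x \<in> cell m (w i)" by metis
  have "(g ^^ i) x \<in> reach g m ((!) (map w [0..<q])) i" if "i \<le> q" for i
    using that by (induction i) (use assms w in auto)
  then have "(g ^^ i) x \<in> reach g m ((!) (map w [0..<q])) i \<inter> cell m (map w [0..<q] ! i)" if "i < q" for i
    using that w(2) by simp
  then have "map w [0..<q] \<in> itineraries q"
    using w(1) unfolding itineraries_def follows_def by (auto simp del: Int_iff)
  then show thesis using that[of "map w [0..<q]"] w(2) by simp
qed

end

section \<open>Entropy and itineraries\<close>

lemma Int_preimages_mem_iterated_join:
  assumes "\<And>i. i < n \<Longrightarrow> V i \<in> \<U>"
  shows "{x \<in> topspace T. \<forall>i<n. (f ^^ i) x \<in> V i} \<in> iterated_join T f \<U> n"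
  using assms
proof (induction n)
  case 0
  then show ?case by simp
next
  case (Suc n)
  let ?A = "{x \<in> topspace T. \<forall>i<n. (f ^^ i) x \<in> V i}"
  let ?B = "{x \<in> topspace T. (f ^^ n) x \<in> V n}"
  have "?A \<in> iterated_join T f \<U> n" using Suc by simp
  moreover have "?B \<in> cover_preimage T (f ^^ n) \<U>"
    using Suc.prems[of n] unfolding cover_preimage_def by (intro image_eqI[of _ _ "V n"]) auto
  moreover have "{x \<in> topspace T. \<forall>i<Suc n. (f ^^ i) x \<in> V i} = ?A \<inter> ?B"
    by (auto simp: less_Suc_eq)
  ultimately show ?case unfolding iterated_join.simps cover_join_def by blast
qed

lemma min_subcover_card_le:
  assumes "\<V> \<subseteq> \<U>" "finite \<V>" "topspace T \<subseteq> \<Union>\<V>"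
  shows "min_subcover_card T \<U> \<le> card \<V>"
  unfolding min_subcover_card_def using assms by (intro cInf_lower) auto

text \<open>Combine a Lebesgue number of the cover with uniform continuity of the first
  iterates.\<close>

lemma fine_cells:
  assumes cont: "continuous_on {0..1} f" and self_map: "f ` {0..1} \<subseteq> {0..1}"
    and \<U>: "open_cover (top_of_set {0..1::real}) \<U>"
  obtains m where "0 < m" "\<And>b i. b < m \<Longrightarrow> i < k \<Longrightarrow> \<exists>U\<in>\<U>. (f ^^ i) ` cell m b \<subseteq> U"
proof -
  \<comment> \<open>The cover is only relatively open, whereas the Lebesgue number is taken for open
    sets of reals.\<close>
  define C where "C = {W. open W \<and> W \<inter> {0..1} \<in> \<U>}"
  have "{0..1} \<subseteq> \<Union>C"
  proof
    fix x :: real assume x: "x \<in> {0..1}"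
    then obtain U where "x \<in> U" "U \<in> \<U>" using \<U> by (auto simp: open_cover_def)
    moreover from this obtain W where "open W" "U = W \<inter> {0..1}"
      using \<U> by (auto simp: open_cover_def openin_open Int_commute)
    ultimately show "x \<in> \<Union>C" by (auto simp: C_def)
  qed
  moreover from this have "C \<noteq> {}" by auto
  ultimately obtain \<delta> where \<delta>: "\<delta> > 0" "\<And>T. T \<subseteq> {0..1} \<Longrightarrow> diameter T < \<delta> \<Longrightarrow> \<exists>B\<in>C. T \<subseteq> B"
    using Lebesgue_number_lemma[of "{0..1::real}" C] unfolding C_def
    by (metis (no_types, lifting) compact_Icc mem_Collect_eq)
  obtain t where t: "t > 0"
    "\<And>s u v. s \<le> k \<Longrightarrow> u \<in> {0..1} \<Longrightarrow> v \<in> {0..1} \<Longrightarrow> dist u v < t \<Longrightarrow>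
       dist ((f ^^ s) u) ((f ^^ s) v) < \<delta> / 2"
    using funpow_uniformly_small[OF compact_Icc cont self_map, of "\<delta> / 2" k] \<delta>(1) by auto
  obtain m where m: "inverse (real (Suc m)) < t"
    using reals_Archimedean[OF t(1)] by blast
  have "\<exists>U\<in>\<U>. (f ^^ i) ` cell (Suc m) b \<subseteq> U" if b: "b < Suc m" and i: "i < k" for b i
  proof -
    let ?T = "(f ^^ i) ` cell (Suc m) b"
    have T: "?T \<subseteq> {0..1}"
      using cell_subset[OF b] funpow_maps_to[OF self_map] by blast
    have "dist u v < t" if "u \<in> cell (Suc m) b" "v \<in> cell (Suc m) b" for u v
    proof -
      have "\<bar>u - v\<bar> \<le> (real b + 1) / real (Suc m) - real b / real (Suc m)"
        using that unfolding cell_def by (auto simp: abs_le_iff)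
      also have "\<dots> = inverse (real (Suc m))"
        by (simp add: diff_divide_distrib[symmetric] inverse_eq_divide)
      finally show ?thesis using m by (simp add: dist_real_def)
    qed
    then have *: "dist ((f ^^ i) u) ((f ^^ i) v) < \<delta> / 2"
      if "u \<in> cell (Suc m) b" "v \<in> cell (Suc m) b" for u v
      using that i cell_subset[OF b] by (intro t(2)) auto
    have "dist y z \<le> \<delta> / 2" if "y \<in> ?T" "z \<in> ?T" for y z
      using that by (elim imageE) (use * in \<open>simp add: less_imp_le\<close>)
    then have "diameter ?T \<le> \<delta> / 2"
      using \<delta>(1) by (intro diameter_le) (auto simp: dist_norm)
    then obtain B where "B \<in> C" "?T \<subseteq> B" using \<delta>(2)[OF T] \<delta>(1) by force
    then show ?thesis using T by (intro bexI[of _ "B \<inter> {0..1}"]) (auto simp: C_def)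
  qed
  then show thesis using that[of "Suc m"] by blast
qed

text \<open>An itinerary of \<open>f ^^ k\<close> fixes a cell at each multiple of \<open>k\<close>.
  Fineness turns this into members of the cover at all times up to the next multiple, hence into one
  element of the join. These elements cover the space, as every orbit has an itinerary.\<close>

lemma min_subcover_card_le_itineraries:
  assumes cont: "continuous_on {0..1} f" and self_map: "f ` {0..1} \<subseteq> {0..1}"
    and "0 < k" "0 < m"
    and fine: "\<And>b i. b < m \<Longrightarrow> i < k \<Longrightarrow> \<exists>U\<in>\<U>. (f ^^ i) ` cell m b \<subseteq> U"
    and n: "n \<le> k * q"
  shows "min_subcover_card (top_of_set {0..1}) (iterated_join (top_of_set {0..1}) f \<U> n) \<le>
    card (interval_map.itineraries (f ^^ k) m q)"
proof -
  interpret interval_map "f ^^ k" m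
    using continuous_on_funpow[OF cont self_map] funpow_maps_to[OF self_map] \<open>0 < m\<close>
    by unfold_locales auto
  obtain U where U: "\<And>b i. b < m \<Longrightarrow> i < k \<Longrightarrow> U b i \<in> \<U> \<and> (f ^^ i) ` cell m b \<subseteq> U b i"
    using fine by metis
  define V where "V ws = {x \<in> topspace (top_of_set {0..1}).
    \<forall>i<n. (f ^^ i) x \<in> U (ws ! (i div k)) (i mod k)}" for ws
  have div: "i div k < q" if "i < n" for i
    using that n \<open>0 < k\<close> by (simp add: div_less_iff_less_mult mult.commute)
  have "V ws \<in> iterated_join (top_of_set {0..1}) f \<U> n" if "ws \<in> itineraries q" for ws
    unfolding V_def using that U div \<open>0 < k\<close>
    by (intro Int_preimages_mem_iterated_join) (auto simp: itineraries_def follows_def)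
  moreover have "topspace (top_of_set {0..1}) \<subseteq> \<Union>(V ` itineraries q)"
  proof
    fix x assume "x \<in> topspace (top_of_set {0..1::real})"
    then have x: "x \<in> {0..1}" by simp
    then obtain ws where ws: "ws \<in> itineraries q" "\<And>i. i < q \<Longrightarrow> ((f ^^ k) ^^ i) x \<in> cell m (ws ! i)"
      using orbit_has_itinerary by blast
    have "(f ^^ i) x \<in> U (ws ! (i div k)) (i mod k)" if "i < n" for i
    proof -
      have "(f ^^ i) x = (f ^^ (i mod k)) (((f ^^ k) ^^ (i div k)) x)"
        unfolding funpow_mult by (metis comp_apply funpow_add mod_mult_div_eq)
      moreover have "ws ! (i div k) < m"
        using ws(1) div[OF that] by (auto simp: itineraries_def follows_def)
      ultimately show ?thesis
        using ws(2)[OF div[OF that]] U[of "ws ! (i div k)" "i mod k"] \<open>0 < k\<close> by auto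
    qed
    then have "x \<in> V ws" using x by (simp add: V_def)
    then show "x \<in> \<Union>(V ` itineraries q)" using ws(1) by blast
  qed
  ultimately have "min_subcover_card (top_of_set {0..1}) (iterated_join (top_of_set {0..1}) f \<U> n)
      \<le> card (V ` itineraries q)"
    using finite_itineraries by (intro min_subcover_card_le) auto
  also have "\<dots> \<le> card (itineraries q)" using finite_itineraries by (rule card_image_le)
  finally show ?thesis .
qed

lemma ln_shift_over_n: "(\<lambda>n. ln (real (n + 2)) / real n) \<longlonglongrightarrow> 0"
proof (rule tendsto_sandwich[of "\<lambda>_. 0" _ _ "\<lambda>n. 2 * (ln (real n) / real n)"])
  show "(\<lambda>n. 2 * (ln (real n) / real n)) \<longlonglongrightarrow> 0"
    by (rule tendsto_mult_right_zero[OF lim_ln_over_n])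
  show "eventually (\<lambda>n. ln (real (n + 2)) / real n \<le> 2 * (ln (real n) / real n)) sequentially"
    using eventually_ge_at_top[of 2]
  proof eventually_elim
    case (elim n)
    have "n + 2 \<le> n * n"
      using mult_le_mono1[OF elim, of n] elim by linarith
    then have "ln (real (n + 2)) \<le> ln (real n * real n)"
      using elim by (intro ln_mono) (simp_all flip: of_nat_mult)
    also have "\<dots> = 2 * ln (real n)"
      using elim by (simp add: ln_mult)
    finally show ?case
      by (simp add: divide_right_mono)
  qed
qed (auto intro!: always_eventually)

text \<open>The number \<open>m\<close> of cells depends on \<open>k\<close>, but it enters the
  bound of \<open>card_itineraries\<close> only as the degree of a polynomial in \<open>n\<close>.
  So the growth rate is at most \<open>ln 4 / k\<close>.\<close>

lemma positive_entropy_imp_horseshoe: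
  assumes cont: "continuous_on {0..1} f" and self_map: "f ` {0..1} \<subseteq> {0..1}"
    and pos: "topological_entropy (top_of_set {0..1}) f > 0"
  obtains N J A B where "0 < N" "segment J" "J \<subseteq> {0..1}" "segment A" "segment B" "A \<subseteq> J" "B \<subseteq> J"
    "A \<inter> B = {}" "(f ^^ N) ` A = J" "(f ^^ N) ` B = J"
proof (rule ccontr)
  assume no: "\<not> thesis"
  obtain \<U> where \<U>: "open_cover (top_of_set {0..1}) \<U>" "cover_entropy (top_of_set {0..1}) f \<U> > 0"
    using pos unfolding topological_entropy_def less_SUP_iff by auto
  define c where "c n = min_subcover_card (top_of_set {0..1}) (iterated_join (top_of_set {0..1}) f \<U> n)" for n
  have "(\<lambda>n. ln (real (c n)) / real n) \<longlonglongrightarrow> 0"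
  proof (rule LIMSEQ_I)
    fix e :: real assume "e > 0"
    obtain k :: nat where k: "real k > 4 * ln 4 / e" using reals_Archimedean2 by blast
    have "0 < 4 * ln 4 / e" using \<open>e > 0\<close> by (intro divide_pos_pos mult_pos_pos) auto
    then have "0 < k" using k by linarith
    have ln4: "ln 4 / real k \<le> e / 4"
      using k \<open>e > 0\<close> \<open>0 < k\<close> by (simp add: field_simps)
    obtain m where m: "0 < m" "\<And>b i. b < m \<Longrightarrow> i < k \<Longrightarrow> \<exists>U\<in>\<U>. (f ^^ i) ` cell m b \<subseteq> U"
      using fine_cells[OF cont self_map \<U>(1), of k] by blast
    interpret interval_map "f ^^ k" m
      using continuous_on_funpow[OF cont self_map] funpow_maps_to[OF self_map] m(1)
      by unfold_locales auto
    \<comment> \<open>A horseshoe for the \<open>n\<close>-th iterate of \<open>f ^^ k\<close> is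
      one for \<open>f ^^ (k * n)\<close>.\<close>
    have "\<not> has_horseshoe"
    proof
      assume has_horseshoe
      then show False
        unfolding has_horseshoe_def funpow_mult
      proof (elim exE conjE)
        fix J A B n
        assume "0 < n" "segment J" "J \<subseteq> {0..1}" "segment A" "segment B" "A \<subseteq> J" "B \<subseteq> J"
          "A \<inter> B = {}" "(f ^^ (k * n)) ` A = J" "(f ^^ (k * n)) ` B = J"
        then show False
          using no that[of "k * n" J A B] \<open>0 < k\<close> by simp
      qed
    qed
    note count = card_itineraries[OF this]
    have bound: "ln (real (c n)) / real n \<le> 2 * real m * (ln (real (n + 2)) / real n) + e / 4 + ln 4 / real n"
      if "n > 0" for n
    proof (cases "c n = 0")
      \<comment> \<open>Here \<open>ln 0 = 0\<close>, and the right-hand side is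
        nonnegative.\<close>
      case True
      then show ?thesis using \<open>e > 0\<close> by simp
    next
      case False
      \<comment> \<open>Rounded up, so that \<open>?q\<close> steps of length \<open>k\<close> reach
        time \<open>n\<close>; still \<open>?q + 1\<close> is at most \<open>n + 2\<close>.\<close>
      let ?q = "n div k + 1"
      have "n \<le> k * ?q"
        using dividend_less_times_div[OF \<open>0 < k\<close>, of n] by simp
      then have "c n \<le> card (itineraries ?q)"
        unfolding c_def
        by (intro min_subcover_card_le_itineraries[OF assms(1,2) \<open>0 < k\<close> m]) auto
      also have "\<dots> \<le> (?q + 1) ^ (2 * m) * 4 ^ ?q"
        by (rule count)
      also have "\<dots> \<le> (n + 2) ^ (2 * m) * 4 ^ ?q"
        by (intro mult_right_mono power_mono) auto
      finally have "real (c n) \<le> real ((n + 2) ^ (2 * m) * 4 ^ ?q)"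
        by (simp only: of_nat_le_iff)
      then have "real (c n) \<le> real (n + 2) ^ (2 * m) * 4 ^ ?q"
        by (simp only: of_nat_mult of_nat_power of_nat_numeral)
      then have "ln (real (c n)) \<le> ln (real (n + 2) ^ (2 * m) * 4 ^ ?q)"
        using False by (intro ln_mono) auto
      also have "\<dots> = 2 * real m * ln (real (n + 2)) + real ?q * ln 4"
        by (simp add: ln_mult ln_realpow del: power_Suc)
      also have "real ?q * ln 4 \<le> (real n / real k + 1) * ln 4"
        using of_nat_div_le_of_nat[of n k] by (intro mult_right_mono) auto
      finally have "ln (real (c n)) \<le> 2 * real m * ln (real (n + 2)) + (real n / real k + 1) * ln 4"
        by simp
      then have "ln (real (c n)) / real n \<le>
          (2 * real m * ln (real (n + 2)) + (real n / real k + 1) * ln 4) / real n"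
        by (rule divide_right_mono) simp
      also have "\<dots> = 2 * real m * (ln (real (n + 2)) / real n) + ln 4 / real k + ln 4 / real n"
        using that by (simp add: field_simps)
      finally show ?thesis using ln4 by linarith
    qed
    have "(\<lambda>n. 2 * real m * (ln (real (n + 2)) / real n) + e / 4 + ln 4 / real n) \<longlonglongrightarrow> 2 * real m * 0 + e / 4 + 0"
      by (intro tendsto_intros ln_shift_over_n lim_const_over_n)
    then have "eventually (\<lambda>n. 2 * real m * (ln (real (n + 2)) / real n) + e / 4 + ln 4 / real n < e) sequentially"
      by (rule order_tendstoD(2)) (use \<open>e > 0\<close> in simp)
    then obtain n0 where n0: "\<And>n. n \<ge> n0 \<Longrightarrow> 2 * real m * (ln (real (n + 2)) / real n) + e / 4 + ln 4 / real n < e"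
      unfolding eventually_sequentially by blast
    have "norm (ln (real (c n)) / real n - 0) < e" if "n \<ge> max n0 1" for n
    proof -
      have "0 \<le> ln (real (c n)) / real n"
        by (cases "c n = 0") auto
      then show ?thesis using bound[of n] n0[of n] that by simp
    qed
    then show "\<exists>n0. \<forall>n\<ge>n0. norm (ln (real (c n)) / real n - 0) < e" by blast
  qed
  then have "cover_entropy (top_of_set {0..1}) f \<U> = 0"
    unfolding cover_entropy_def c_def by (rule limI)
  then show False using \<U>(2) by simp
qed

section \<open>Horseshoes\<close>

text \<open>\<open>N\<close> is kept apart from \<open>f\<close> because horseshoes of various
  iterates occur, while distributional chaos always refers to \<open>f\<close> itself.\<close>

locale horseshoe =
  fixes f :: "real \<Rightarrow> real" and N :: nat and I :: "bool \<Rightarrow> real set" and J :: "real set"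
  assumes cont: "continuous_on {0..1} f" and self_map: "f ` {0..1} \<subseteq> {0..1}"
    and N_pos: "0 < N"
    and J: "segment J" "J \<subseteq> {0..1}"
    and I: "segment (I a)" "I a \<subseteq> J"
    and onto: "(f ^^ N) ` I a = J"
    and disj: "I False \<inter> I True = {}"
begin

abbreviation g where "g \<equiv> f ^^ N"

lemma cont_g: "A \<subseteq> J \<Longrightarrow> continuous_on A g"
  using continuous_on_funpow[OF cont self_map] J(2) continuous_on_subset by blast

lemma g_iterate: "(g ^^ i) x = (f ^^ (N * i)) x"
  by (simp add: funpow_mult)

definition pullback :: "real set \<Rightarrow> real set \<Rightarrow> real set" where
  "pullback A B = (SOME C. C \<subseteq> A \<and> segment C \<and> g ` C = B)"

lemma pullback:
  assumes "segment A" "A \<subseteq> J" "segment B" "B \<subseteq> g ` A"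
  shows "pullback A B \<subseteq> A" "segment (pullback A B)" "g ` pullback A B = B"
proof -
  have "\<exists>C. C \<subseteq> A \<and> segment C \<and> g ` C = B"
    by (rule segment_pullback[OF assms(1,3) cont_g[OF assms(2)] assms(4)]) blast
  then have "pullback A B \<subseteq> A \<and> segment (pullback A B) \<and> g ` pullback A B = B"
    unfolding pullback_def by (rule someI_ex)
  then show "pullback A B \<subseteq> A" "segment (pullback A B)" "g ` pullback A B = B"
    by auto
qed

text \<open>
  The \<open>N\<close>-step itinerary of every point of \<open>cyl u\<close> begins with \<open>u\<close>. The pullbacks are chosen inside
  the cylinder of the shorter word, so that the cylinders are nested as well as equivariant.
\<close>

fun cyl :: "bool list \<Rightarrow> real set" where
  "cyl [] = J"
| "cyl [a] = I a"
| "cyl (a # b # v) = pullback (cyl (butlast (a # b # v))) (cyl (b # v))"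

text \<open>One induction for all parts: the pullback for \<open>a # b # v\<close> requires
  \<open>cyl (b # v)\<close> to lie in the image of the shorter cylinder, and this is the nesting
  property of the tail.\<close>

lemma cyl_basic:
  "segment (cyl u) \<and> cyl u \<subseteq> J \<and>
   (u \<noteq> [] \<longrightarrow> cyl u \<subseteq> cyl (butlast u) \<and> cyl u \<subseteq> I (hd u) \<and> g ` cyl u = cyl (tl u))"
proof (induction u rule: cyl.induct)
  case 1
  then show ?case using J by simp
next
  case (2 a)
  then show ?case using I onto by simp
next
  case (3 a b v)
  let ?u = "a # b # v"
  have IH: "segment (cyl (butlast ?u))" "cyl (butlast ?u) \<subseteq> J"
      "cyl (butlast ?u) \<subseteq> I a" "g ` cyl (butlast ?u) = cyl (butlast (b # v))"
    using 3(1) by simp_all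
  have IH': "segment (cyl (b # v))" "cyl (b # v) \<subseteq> cyl (butlast (b # v))"
    using 3(2) by simp_all
  have "cyl (b # v) \<subseteq> g ` cyl (butlast ?u)"
    using IH(4) IH'(2) by simp
  from pullback[OF IH(1,2) IH'(1) this]
  have "cyl ?u \<subseteq> cyl (butlast ?u)" "segment (cyl ?u)" "g ` cyl ?u = cyl (b # v)"
    by simp_all
  moreover have "cyl ?u \<subseteq> J" "cyl ?u \<subseteq> I a"
    using IH(2,3) calculation(1) by (meson order_trans)+
  ultimately show ?case by simp
qed

lemma segment_cyl: "segment (cyl u)" and cyl_subset: "cyl u \<subseteq> J"
  using cyl_basic by auto

lemma cyl_Cons: "cyl (a # u) \<subseteq> I a" and image_cyl_Cons: "g ` cyl (a # u) = cyl u"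
  using cyl_basic[of "a # u"] by auto

lemma cyl_append: "cyl (u @ v) \<subseteq> cyl u"
proof (induction v rule: rev_induct)
  case (snoc a v)
  then show ?case using cyl_basic[of "u @ v @ [a]"] by (auto simp: butlast_append)
qed simp

lemma image_cyl_append: "(g ^^ length u) ` cyl (u @ v) = cyl v"
proof (induction u)
  case (Cons a u)
  have "(g ^^ length (a # u)) ` cyl (a # u @ v) = (g ^^ length u) ` g ` cyl (a # u @ v)"
    by (simp only: list.size funpow_Suc_right image_comp add_0_right add_Suc_right)
  then show ?case
    using Cons by (simp add: image_cyl_Cons)
qed simp

lemma cyl_same_length:
  "length u = length v \<Longrightarrow> x \<in> cyl u \<Longrightarrow> x \<in> cyl v \<Longrightarrow> u = v"
proof (induction u v arbitrary: x rule: list_induct2)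
  case (Cons a u b v)
  have "x \<in> I a" "x \<in> I b" using Cons.prems cyl_Cons by blast+
  then have "a = b" using disj by (cases a; cases b) auto
  moreover have "g x \<in> cyl u" "g x \<in> cyl v"
    using Cons.prems image_cyl_Cons by blast+
  ultimately show ?case using Cons.IH by blast
qed simp

lemma cyl_prefix:
  assumes "x \<in> cyl u" "x \<in> cyl v" "length u \<le> length v"
  shows "u = take (length u) v"
  using assms cyl_append[of "take (length u) v" "drop (length u) v"]
  by (intro cyl_same_length[of _ _ x]) auto

section \<open>Infinite words and their fibres\<close>

abbreviation pre :: "(nat \<Rightarrow> bool) \<Rightarrow> nat \<Rightarrow> bool list" where
  "pre \<omega> m \<equiv> map \<omega> [0..<m]"

lemma pre_add: "pre \<omega> (i + m) = pre \<omega> i @ pre (\<lambda>j. \<omega> (i + j)) m"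
  by (rule nth_equalityI) (auto simp: nth_append)

text \<open>No expansion is assumed, so a fibre may be a nondegenerate interval.\<close>

definition fibre :: "(nat \<Rightarrow> bool) \<Rightarrow> real set" where
  "fibre \<omega> = (\<Inter>m. cyl (pre \<omega> m))"

lemma fibre_D: "x \<in> fibre \<omega> \<Longrightarrow> x \<in> cyl (pre \<omega> m)"
  by (auto simp: fibre_def)

lemma cyl_pre_mono: "m \<le> n \<Longrightarrow> cyl (pre \<omega> n) \<subseteq> cyl (pre \<omega> m)"
  using cyl_append[of "pre \<omega> m"] pre_add[of \<omega> m "n - m"] by simp

lemma fibre_subset: "fibre \<omega> \<subseteq> J"
  using fibre_D[of _ \<omega> 0] by auto

lemma segment_fibre: "segment (fibre \<omega>)"
proof -
  have cl: "compact (cyl (pre \<omega> m))" "connected (cyl (pre \<omega> m))" "cyl (pre \<omega> m) \<noteq> {}" for m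
    using segment_cyl by (auto simp: segment_def)
  have "fibre \<omega> \<noteq> {}"
    unfolding fibre_def using cl cyl_pre_mono by (intro compact_nest) auto
  moreover have "compact (fibre \<omega>)"
    unfolding fibre_def using cl(1) by (intro compact_Inter) auto
  moreover have "connected (fibre \<omega>)"
    unfolding fibre_def connected_convex_1
    using cl(2) by (intro convex_INT) (simp add: connected_convex_1)
  ultimately show ?thesis by (simp add: segment_def)
qed

lemma fibre_disjoint: "\<omega> \<noteq> \<omega>' \<Longrightarrow> fibre \<omega> \<inter> fibre \<omega>' = {}"
proof (rule ccontr)
  assume "\<omega> \<noteq> \<omega>'" and "fibre \<omega> \<inter> fibre \<omega>' \<noteq> {}"
  then obtain i x where x: "\<omega> i \<noteq> \<omega>' i" "x \<in> fibre \<omega>" "x \<in> fibre \<omega>'"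
    unfolding fun_eq_iff by blast
  have "pre \<omega> (Suc i) = pre \<omega>' (Suc i)"
    using fibre_D[OF x(2)] fibre_D[OF x(3)] by (rule cyl_same_length[rotated]) simp
  then show False using x(1) by simp
qed

lemma fibre_orbit:
  assumes "x \<in> fibre \<omega>"
  shows "(g ^^ i) x \<in> cyl (pre (\<lambda>j. \<omega> (i + j)) m)"
proof -
  have "x \<in> cyl (pre \<omega> i @ pre (\<lambda>j. \<omega> (i + j)) m)"
    using fibre_D[OF assms, of "i + m"] by (simp only: pre_add)
  then show ?thesis
    using image_cyl_append[of "pre \<omega> i"] by fastforce
qed

lemma fibre_orbit_I:
  assumes "x \<in> fibre \<omega>"
  shows "(g ^^ i) x \<in> I (\<omega> i)"
  using fibre_orbit[OF assms, of i 1] by simp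

text \<open>The sets \<open>cyl (pre \<omega> m) - U\<close> are compact and nested with empty
  intersection, so one of them is empty.\<close>

lemma fibre_shrinks:
  assumes "fibre \<omega> \<subseteq> U" "open U"
  obtains m where "cyl (pre \<omega> m) \<subseteq> U"
proof -
  have "\<exists>m. cyl (pre \<omega> m) \<subseteq> U"
  proof (rule ccontr)
    assume "\<not> ?thesis"
    moreover have "compact (cyl (pre \<omega> m) - U)" for m
      using segment_cyl assms(2) by (intro compact_diff) (simp_all add: segment_def)
    moreover have "cyl (pre \<omega> n) - U \<subseteq> cyl (pre \<omega> m) - U" if "m \<le> n" for m n
      using cyl_pre_mono[OF that] by (rule Diff_mono) simp
    ultimately have "\<Inter>(range (\<lambda>m. cyl (pre \<omega> m) - U)) \<noteq> {}"
      by (intro compact_nest) simp_all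
    then show False using assms(1) by (auto simp: fibre_def)
  qed
  then show thesis using that by blast
qed

lemma countable_fat_fibres: "countable {\<omega>. \<exists>x\<in>fibre \<omega>. \<exists>y\<in>fibre \<omega>. x \<noteq> y}"
  using segment_fibre fibre_disjoint by (rule countable_nondegenerate_segments)

section \<open>A scrambled set in a horseshoe\<close>

text \<open>
  The cylinders of \<open>0\<^sup>j 1\<close> are pairwise disjoint, so their lengths tend to zero, even though
  cylinders of long words need not be small in general.
\<close>

lemma escape_cylinders_small:
  assumes "e > 0"
  obtains j0 where
    "\<And>j x y. j0 \<le> j \<Longrightarrow> x \<in> cyl (replicate j False @ [True]) \<Longrightarrow>
       y \<in> cyl (replicate j False @ [True]) \<Longrightarrow> dist x y < e"
proof -
  let ?K = "\<lambda>j. cyl (replicate j False @ [True])"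
  have ne: "?K i \<inter> ?K j = {}" if ij: "i < j" for i j
  proof (rule ccontr)
    assume "\<not> ?thesis"
    then obtain x where "x \<in> ?K i" "x \<in> ?K j" by auto
    then have "replicate i False @ [True] = take (Suc i) (replicate j False @ [True])"
      using cyl_prefix[of x "replicate i False @ [True]"] ij by force
    then have "(replicate i False @ [True]) ! i = (replicate j False @ [True]) ! i"
      by (metis lessI nth_take)
    then show False using ij by (simp add: nth_append)
  qed
  have "?K i \<inter> ?K j = {}" if "i \<noteq> j" for i j
    using ne[of i j] ne[of j i] that by (cases "i < j") auto
  moreover have "?K i \<subseteq> {0..1}" for i
    using cyl_subset J(2) by blast
  ultimately have "finite {j. \<exists>x\<in>?K j. \<exists>y\<in>?K j. dist x y \<ge> e}"
    using segment_cyl assms by (intro finite_long_segments) auto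
  then obtain j0 where j0: "\<And>j. j \<in> {j. \<exists>x\<in>?K j. \<exists>y\<in>?K j. dist x y \<ge> e} \<Longrightarrow> j < j0"
    unfolding finite_nat_set_iff_bounded by blast
  show thesis
  proof (rule that)
    fix j x y assume "j0 \<le> j" "x \<in> ?K j" "y \<in> ?K j"
    then show "dist x y < e" using j0[of j] by force
  qed
qed

end

section \<open>Limits of the distribution functions\<close>

lemma Psi_n_bounds: "0 \<le> Psi_n f x y t n" "Psi_n f x y t n \<le> 1"
proof -
  have "xi f x y t n \<le> card {..<n}"
    unfolding xi_def by (rule card_mono) auto
  then show "0 \<le> Psi_n f x y t n" "Psi_n f x y t n \<le> 1"
    by (auto simp: Psi_n_def divide_le_eq_1)
qed

text \<open>No point forms a DC1-pair with itself; this will show that different codes give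
  different points.\<close>

lemma Psi_lower_self: "t > 0 \<Longrightarrow> Psi_lower f x x t = 1"
proof -
  assume "t > 0"
  have "eventually (\<lambda>n. ereal (Psi_n f x x t n) = 1) sequentially"
    using eventually_gt_at_top[of 0]
    by eventually_elim (use \<open>t > 0\<close> in \<open>simp add: Psi_n_def xi_def\<close>)
  then have "Psi_lower f x x t = liminf (\<lambda>n. 1)"
    unfolding Psi_lower_def by (rule Liminf_eq)
  then show ?thesis by (simp add: Liminf_const)
qed

lemma uncountable_UNIV_bool_seq: "uncountable (UNIV :: (nat \<Rightarrow> bool) set)"
proof
  assume "countable (UNIV :: (nat \<Rightarrow> bool) set)"
  then obtain s :: "nat \<Rightarrow> nat \<Rightarrow> bool" where "range s = UNIV"
    using uncountable_def by blast
  then obtain n where "s n = (\<lambda>i. \<not> s i i)" by (metis UNIV_I imageE)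
  then show False by (metis (full_types))
qed

lemma Psi_upper_eq_1:
  assumes "\<And>e n0. e > 0 \<Longrightarrow> \<exists>n\<ge>n0. Psi_n f x y t n \<ge> 1 - e"
  shows "Psi_upper f x y t = 1"
proof (rule antisym)
  show "Psi_upper f x y t \<le> 1"
    unfolding Psi_upper_def by (rule Limsup_bounded) (simp add: Psi_n_bounds)
  show "1 \<le> Psi_upper f x y t"
  proof (rule ccontr)
    assume "\<not> ?thesis"
    then have "Psi_upper f x y t < 1" by simp
    then obtain c where c: "Psi_upper f x y t < ereal c" "ereal c < 1"
      using ereal_dense2 by blast
    then have "eventually (\<lambda>n. ereal (Psi_n f x y t n) < ereal c) sequentially"
      unfolding Psi_upper_def by (intro Limsup_lessD)
    then obtain n0 where n0: "\<And>n. n \<ge> n0 \<Longrightarrow> Psi_n f x y t n < c"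
      by (auto simp: eventually_sequentially)
    obtain n where "n \<ge> n0" "Psi_n f x y t n \<ge> 1 - (1 - c)"
      using assms[of "1 - c" n0] c(2) by auto
    then show False using n0[of n] by simp
  qed
qed

lemma Psi_lower_eq_0:
  assumes "\<And>e n0. e > 0 \<Longrightarrow> \<exists>n\<ge>n0. Psi_n f x y t n \<le> e"
  shows "Psi_lower f x y t = 0"
proof (rule antisym)
  show "0 \<le> Psi_lower f x y t"
    unfolding Psi_lower_def by (rule Liminf_bounded) (simp add: Psi_n_bounds)
  show "Psi_lower f x y t \<le> 0"
  proof (rule ccontr)
    assume "\<not> ?thesis"
    then have "0 < Psi_lower f x y t" by simp
    then obtain c where c: "0 < ereal c" "ereal c < Psi_lower f x y t"
      using ereal_dense2 by blast
    then have "eventually (\<lambda>n. ereal c < ereal (Psi_n f x y t n)) sequentially"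
      unfolding Psi_lower_def by (intro less_LiminfD)
    then obtain n0 where n0: "\<And>n. n \<ge> n0 \<Longrightarrow> c < Psi_n f x y t n"
      by (auto simp: eventually_sequentially)
    obtain n where "n \<ge> n0" "Psi_n f x y t n \<le> c"
      using assms[of c n0] c(1) by auto
    then show False using n0[of n] by simp
  qed
qed

section \<open>Itineraries in factorial blocks\<close>

context horseshoe
begin

text \<open>
  On the block \<open>[k!, (k+1)!)\<close> the itinerary is \<open>0 \<dots> 0 1\<close> for even \<open>k\<close>, while for odd \<open>k\<close> it is constant,
  each digit of \<open>b\<close> being used for infinitely many \<open>k\<close>.
\<close>

definition block :: "nat \<Rightarrow> nat" where
  "block i = (LEAST k. i < fact (Suc k))"

definition code :: "(nat \<Rightarrow> bool) \<Rightarrow> nat \<Rightarrow> bool" where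
  "code b i = (let k = block i in
     if even k then Suc i = fact (Suc k) else b (fst (prod_decode (k div 2))))"

lemma block_eq:
  assumes "fact k \<le> i" "i < fact (Suc k)"
  shows "block i = k"
  unfolding block_def
proof (rule Least_equality)
  fix k' assume "i < fact (Suc k')"
  show "k \<le> k'"
  proof (rule ccontr)
    assume "\<not> k \<le> k'"
    then have "fact (Suc k') \<le> (fact k :: nat)" by (intro fact_mono) simp
    then show False using assms(1) \<open>i < fact (Suc k')\<close> by simp
  qed
qed fact

lemma replicate_then: "map (\<lambda>l. l = j) [0..<Suc j] = replicate j False @ [True]"
  by (rule nth_equalityI) (auto simp: nth_append simp del: upt_Suc)

text \<open>Whatever \<open>b\<close> is, the rest of an even block consists of zeros and a final
  one, and its length alone determines the cylinder.\<close>

lemma code_even_block: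
  assumes x: "x \<in> fibre (code b)" and k: "even k" and i: "fact k \<le> i" "i < fact (Suc k)"
  shows "(g ^^ i) x \<in> cyl (replicate (fact (Suc k) - Suc i) False @ [True])"
proof -
  let ?j = "fact (Suc k) - Suc i"
  have "code b (i + l) = (l = ?j)" if "l < Suc ?j" for l
    using block_eq[of k "i + l"] that i k by (auto simp: code_def)
  then have "pre (\<lambda>l. code b (i + l)) (Suc ?j) = map (\<lambda>l. l = ?j) [0..<Suc ?j]"
    by (intro map_cong) auto
  then show ?thesis
    using fibre_orbit[OF x, of i "Suc ?j"] by (simp only: replicate_then)
qed

lemma code_odd_block:
  assumes "fact k \<le> i" "i < fact (Suc k)" "k = 2 * prod_encode (j, l) + 1"
  shows "code b i = b j"
  using block_eq[OF assms(1,2)] assms(3) by (simp add: code_def)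

text \<open>As \<open>(k+1)! = (k+1) k!\<close>, the times before block \<open>k\<close> are
  negligible at its end for large \<open>k\<close>.\<close>

lemma block_ratio:
  assumes "c \<le> e * real k" "0 \<le> e"
  shows "c * real (fact k) \<le> e * real (fact (Suc k))"
proof -
  have "c * real (fact k) \<le> (e * real k) * real (fact k)"
    using assms(1) by (rule mult_right_mono) simp
  also have "\<dots> \<le> e * real (fact (Suc k))"
    using assms(2) by (simp add: algebra_simps)
  finally show ?thesis .
qed

lemma le_block_end: "k \<le> N * fact (Suc k)"
proof -
  have "1 * k \<le> N * fact (Suc k)"
    using N_pos fact_ge_self[of "Suc k"] by (intro mult_le_mono) linarith+
  then show ?thesis by simp
qed

text \<open>In an even block both orbits under \<open>g\<close> share an escape cylinder, which is
  small except at the last \<open>j0\<close> positions. So at most \<open>N * (k! + j0)\<close>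
  times up to the end of the block are bad.\<close>

lemma fibre_code_upper:
  assumes x: "x \<in> fibre (code b)" and y: "y \<in> fibre (code b')" and "t > 0"
  shows "Psi_upper f x y t = 1"
proof (rule Psi_upper_eq_1)
  fix e :: real and n0 :: nat assume "e > 0"
  have J01: "u \<in> {0..1}" if "u \<in> cyl w" for u w
    using that cyl_subset J(2) by blast
  obtain t' where t': "t' > 0"
    "\<And>s u v. s \<le> N \<Longrightarrow> u \<in> {0..1} \<Longrightarrow> v \<in> {0..1} \<Longrightarrow> dist u v < t' \<Longrightarrow>
       dist ((f ^^ s) u) ((f ^^ s) v) < t"
    using funpow_uniformly_small[OF compact_Icc cont self_map \<open>t > 0\<close>, of N] by blast
  obtain j0 where j0: "\<And>j u v. j0 \<le> j \<Longrightarrow> u \<in> cyl (replicate j False @ [True]) \<Longrightarrow>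
       v \<in> cyl (replicate j False @ [True]) \<Longrightarrow> dist u v < t'"
    using escape_cylinders_small[OF t'(1)] by blast
  \<comment> \<open>Even, at least \<open>n0\<close>, and large enough for
    \<open>block_ratio\<close> with the constant \<open>j0 + 1\<close>, since \<open>j0 + k!\<close>
    is at most \<open>(j0 + 1) k!\<close>.\<close>
  define k where "k = 2 * (n0 + nat \<lceil>(real j0 + 1) / e\<rceil>)"
  have k: "even k" "n0 \<le> k" "(real j0 + 1) / e \<le> k"
    unfolding k_def by (auto simp: of_nat_nat) linarith
  let ?F = "fact (Suc k) :: nat"
  have close: "dist ((f ^^ i) x) ((f ^^ i) y) < t"
    if i: "N * fact k \<le> i" "i < N * (?F - j0)" for i
  proof -
    let ?q = "i div N"
    have q: "fact k \<le> ?q" "?q < ?F - j0"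
      using i N_pos by (auto simp: less_eq_div_iff_mult_less_eq div_less_iff_less_mult mult.commute)
    then have "?q < ?F" "j0 \<le> ?F - Suc ?q" by auto
    then have gq: "(g ^^ ?q) x \<in> cyl (replicate (?F - Suc ?q) False @ [True])"
        "(g ^^ ?q) y \<in> cyl (replicate (?F - Suc ?q) False @ [True])"
      using code_even_block[OF x k(1) q(1)] code_even_block[OF y k(1) q(1)] by auto
    then have "dist ((f ^^ (i mod N)) ((g ^^ ?q) x)) ((f ^^ (i mod N)) ((g ^^ ?q) y)) < t"
      using j0[OF \<open>j0 \<le> ?F - Suc ?q\<close> gq] N_pos
      by (intro t'(2)) (auto intro: J01[OF gq(1)] J01[OF gq(2)] simp del: atLeastAtMost_iff)
    moreover have "(f ^^ (i mod N)) ((g ^^ ?q) z) = (f ^^ i) z" for z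
      unfolding g_iterate by (metis comp_apply funpow_add mod_mult_div_eq)
    ultimately show ?thesis by simp
  qed
  have "{N * fact k..<N * (?F - j0)} \<subseteq> {i. i < N * ?F \<and> dist ((f ^^ i) x) ((f ^^ i) y) < t}"
    using close by (auto elim!: order.strict_trans2 simp: N_pos)
  then have "card {N * fact k..<N * (?F - j0)} \<le> xi f x y t (N * ?F)"
    unfolding xi_def by (intro card_mono) simp_all
  then have "N * (?F - j0) - N * fact k \<le> xi f x y t (N * ?F)"
    by (simp only: card_atLeastLessThan)
  \<comment> \<open>Truncated subtraction does no harm: if a difference is cut off at 0, this
    inequality holds anyway.\<close>
  then have "N * ?F \<le> xi f x y t (N * ?F) + N * (j0 + fact k)"
    by (simp only: diff_mult_distrib2 add_mult_distrib2)
  then have "real (N * ?F) \<le> real (xi f x y t (N * ?F)) + real N * real (j0 + fact k)"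
    by (metis of_nat_add of_nat_le_iff of_nat_mult)
  moreover have "real (j0 + fact k) \<le> (real j0 + 1) * real (fact k)"
    using mult_left_mono[of 1 "fact k" "real j0"] by (simp add: distrib_right fact_ge_1)
  moreover have "(real j0 + 1) * real (fact k) \<le> e * real ?F"
    using block_ratio[of "real j0 + 1" e k] k(3) \<open>e > 0\<close> by (simp add: pos_divide_le_eq mult.commute)
  ultimately have "real (N * ?F) \<le> real (xi f x y t (N * ?F)) + real N * (e * real ?F)"
    by (meson add_left_mono mult_left_mono of_nat_0_le_iff order_trans)
  then have "real (N * ?F) * (1 - e) \<le> real (xi f x y t (N * ?F))"
    by (simp only: of_nat_mult right_diff_distrib mult_1_right) (simp only: mult_ac diff_le_eq)
  then have "1 - e \<le> Psi_n f x y t (N * ?F)"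
    unfolding Psi_n_def using N_pos by (simp add: pos_le_divide_eq mult.commute del: of_nat_mult fact_Suc)
  moreover have "n0 \<le> N * ?F"
    using le_block_end[of k] k(2) by linarith
  ultimately show "\<exists>n\<ge>n0. Psi_n f x y t n \<ge> 1 - e" by blast
qed

text \<open>Some digits \<open>b j\<close> and \<open>b' j\<close> differ. On infinitely many odd
  blocks the codes are constant with these values, so the orbits under \<open>g\<close> stay in
  different branches.\<close>

lemma fibre_code_lower:
  assumes x: "x \<in> fibre (code b)" and y: "y \<in> fibre (code b')" and "b \<noteq> b'"
  shows "\<exists>t>0. Psi_lower f x y t = 0"
proof -
  obtain j where j: "b j \<noteq> b' j" using \<open>b \<noteq> b'\<close> by auto
  have "setdist (I False) (I True) > 0"
    using I(1) disj by (simp add: setdist_gt_0_compact_closed segment_def compact_imp_closed)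
  \<comment> \<open>Points closer than \<open>t\<close> would still be closer than the distance of
    the branches at the next multiple of \<open>N\<close>. This \<open>t\<close> is the same for all
    blocks.\<close>
  then obtain t where t: "t > 0"
    "\<And>s u v. s \<le> N \<Longrightarrow> u \<in> {0..1} \<Longrightarrow> v \<in> {0..1} \<Longrightarrow> dist u v < t \<Longrightarrow>
       dist ((f ^^ s) u) ((f ^^ s) v) < setdist (I False) (I True)"
    using funpow_uniformly_small[OF compact_Icc cont self_map, of "setdist (I False) (I True)" N]
    by blast
  have x01: "x \<in> {0..1}" and y01: "y \<in> {0..1}"
    using x y fibre_subset J(2) by blast+
  have "Psi_lower f x y t = 0"
  proof (rule Psi_lower_eq_0)
    fix e :: real and n0 :: nat assume "e > 0"
    \<comment> \<open>\<open>l\<close> selects one of the infinitely many blocks that use digit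
      \<open>j\<close>; it is at most \<open>k\<close> and so makes \<open>k\<close> large.\<close>
    define l where "l = n0 + nat \<lceil>2 / e\<rceil>"
    define k where "k = 2 * prod_encode (j, l) + 1"
    have "l \<le> k"
      using le_prod_encode_2[of l j] by (simp add: k_def)
    then have k: "n0 \<le> k" "2 / e \<le> k"
      unfolding l_def by linarith+
    let ?F = "fact (Suc k) :: nat"
    have far: "t \<le> dist ((f ^^ i) x) ((f ^^ i) y)"
      if i: "N * fact k \<le> i" "i < N * (?F - 1)" for i
    proof (rule ccontr)
      assume near: "\<not> ?thesis"
      \<comment> \<open>\<open>N * ?q\<close> is the first multiple of \<open>N\<close> strictly
        after \<open>i\<close>; the bound \<open>?F - 1\<close> keeps \<open>?q\<close> inside the
        block.\<close>
      let ?q = "Suc (i div N)"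
      have q: "fact k \<le> ?q" "?q < ?F"
      proof -
        have "fact k \<le> i div N" "i div N < ?F - 1"
          using i N_pos by (simp_all add: less_eq_div_iff_mult_less_eq div_less_iff_less_mult mult.commute)
        then show "fact k \<le> ?q" "?q < ?F" by linarith+
      qed
      let ?s = "N - i mod N"
      have s: "?s + i = N * ?q"
        using mod_less_divisor[OF N_pos, of i] mult_div_mod_eq[of N i] unfolding mult_Suc_right by linarith
      have "dist ((f ^^ ?s) ((f ^^ i) x)) ((f ^^ ?s) ((f ^^ i) y)) < setdist (I False) (I True)"
        using near by (intro t(2) funpow_maps_to[OF self_map] x01 y01) auto
      moreover have "(f ^^ ?s) ((f ^^ i) z) = (g ^^ ?q) z" for z
        unfolding g_iterate by (simp only: s[symmetric] funpow_add comp_apply)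
      ultimately have "dist ((g ^^ ?q) x) ((g ^^ ?q) y) < setdist (I False) (I True)" by simp
      moreover have "(g ^^ ?q) x \<in> I (b j)" "(g ^^ ?q) y \<in> I (b' j)"
        using fibre_orbit_I[OF x, of ?q] fibre_orbit_I[OF y, of ?q] code_odd_block[OF q k_def] by simp_all
      ultimately show False
        using j setdist_le_dist[of _ "I False" _ "I True"]
        by (cases "b j"; cases "b' j") (fastforce simp: dist_commute)+
    qed
    have "{i. i < N * ?F \<and> dist ((f ^^ i) x) ((f ^^ i) y) < t} \<subseteq>
        {..<N * fact k} \<union> {N * (?F - 1)..<N * ?F}"
    proof
      fix i assume i: "i \<in> {i. i < N * ?F \<and> dist ((f ^^ i) x) ((f ^^ i) y) < t}"
      then have "\<not> t \<le> dist ((f ^^ i) x) ((f ^^ i) y)" by simp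
      then have "\<not> (N * fact k \<le> i \<and> i < N * (?F - 1))"
        using far[of i] by blast
      then have "i < N * fact k \<or> N * (?F - 1) \<le> i" by linarith
      then show "i \<in> {..<N * fact k} \<union> {N * (?F - 1)..<N * ?F}"
        using i by (simp only: Un_iff lessThan_iff atLeastLessThan_iff mem_Collect_eq) blast
    qed
    then have "xi f x y t (N * ?F) \<le> card ({..<N * fact k} \<union> {N * (?F - 1)..<N * ?F})"
      unfolding xi_def by (intro card_mono) auto
    also have "\<dots> \<le> N * fact k + (N * ?F - N * (?F - 1))"
      using card_Un_le[of "{..<N * fact k}" "{N * (?F - 1)..<N * ?F}"] by simp
    also have "N * ?F - N * (?F - 1) = N"
      by (metis diff_diff_cancel diff_mult_distrib2 fact_ge_1 mult.right_neutral)
    finally have "xi f x y t (N * ?F) \<le> N * (fact k + 1)" by simp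
    then have "real (xi f x y t (N * ?F)) \<le> real N * real (fact k + 1)"
      by (metis of_nat_le_iff of_nat_mult)
    moreover have "real (fact k + 1) \<le> 2 * real (fact k)"
      by (simp add: fact_ge_1)
    moreover have "2 * real (fact k) \<le> e * real ?F"
      using block_ratio[of 2 e k] k(2) \<open>e > 0\<close> by (simp add: pos_divide_le_eq mult.commute)
    ultimately have "real (xi f x y t (N * ?F)) \<le> real N * (e * real ?F)"
      by (meson mult_left_mono of_nat_0_le_iff order_trans)
    then have "real (xi f x y t (N * ?F)) \<le> e * real (N * ?F)"
      by (simp only: of_nat_mult mult_ac)
    then have "Psi_n f x y t (N * ?F) \<le> e"
      unfolding Psi_n_def using N_pos by (simp add: pos_divide_le_eq del: of_nat_mult fact_Suc)
    moreover have "n0 \<le> N * ?F"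
      using le_block_end[of k] k(1) by linarith
    ultimately show "\<exists>n\<ge>n0. Psi_n f x y t n \<le> e" by blast
  qed
  then show ?thesis using t(1) by blast
qed

text \<open>The closed set for a DC1-point will be a single branch, so the scrambled set has to lie
  in one. Of the two parts of \<open>range p\<close>, one is uncountable.\<close>

lemma uncountable_scrambled_set:
  obtains S a where "uncountable S" "S \<subseteq> I a" "DC1_scrambled {0..1} f S"
proof -
  define p where "p b = (SOME x. x \<in> fibre (code b))" for b
  have p: "p b \<in> fibre (code b)" for b
  proof -
    have "\<exists>x. x \<in> fibre (code b)"
      using segment_fibre[of "code b"] by (auto simp: segment_def)
    then show ?thesis unfolding p_def by (rule someI_ex)
  qed
  have pair: "DC1_pair f (p b) (p b')" if "b \<noteq> b'" for b b'
    unfolding DC1_pair_def using fibre_code_upper[OF p p] fibre_code_lower[OF p p that] by blast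
  have "inj p"
  proof (rule injI, rule ccontr)
    fix b b' assume "p b = p b'" "b \<noteq> b'"
    then show False
      using fibre_code_lower[OF p p] Psi_lower_self by (metis zero_neq_one)
  qed
  then have "uncountable (range p)"
    using uncountable_UNIV_bool_seq countable_image_inj_on by blast
  moreover have "range p \<subseteq> I False \<union> I True"
  proof (rule image_subsetI)
    fix b show "p b \<in> I False \<union> I True"
      using fibre_orbit_I[OF p, of 0 b] by (cases "code b 0") auto
  qed
  then have "range p = (range p \<inter> I False) \<union> (range p \<inter> I True)" by auto
  ultimately obtain a where a: "uncountable (range p \<inter> I a)"
    by (metis countable_Un)
  have "range p \<inter> I a \<subseteq> {0..1}" using I(2) J(2) by blast
  then have "DC1_scrambled {0..1} f (range p \<inter> I a)"
    unfolding DC1_scrambled_def using pair by (metis IntD1 imageE)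
  then show thesis using that a by blast
qed

section \<open>DC1-points and a Cantor set of them\<close>

lemma subhorseshoe:
  "horseshoe f (N * (Suc (length u))) (\<lambda>a. cyl (u @ a # u)) (cyl u)"
proof
  show "continuous_on {0..1} f" "f ` {0..1} \<subseteq> {0..1}" by (fact cont self_map)+
  show "0 < N * Suc (length u)" using N_pos by simp
  show "segment (cyl u)" "cyl u \<subseteq> {0..1}" using segment_cyl cyl_subset J(2) by blast+
  \<comment> \<open>The word starts with \<open>u\<close>, which puts the branch into
    \<open>cyl u\<close>, and removing its first \<open>length u + 1\<close> letters leaves
    \<open>u\<close> again.\<close>
  show "segment (cyl (u @ a # u))" "cyl (u @ a # u) \<subseteq> cyl u" for a
    using segment_cyl cyl_append by auto
  show "(f ^^ (N * Suc (length u))) ` cyl (u @ a # u) = cyl u" for a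
    using image_cyl_append[of "u @ [a]" u] by (simp add: funpow_mult del: funpow.simps)
  show "cyl (u @ False # u) \<inter> cyl (u @ True # u) = {}"
    using cyl_same_length[of "u @ False # u" "u @ True # u"] by auto
qed

text \<open>As the fibre is a point, some \<open>cyl u\<close> lies in the ball. A branch of the
  horseshoe over \<open>cyl u\<close> is contained in its own image, which is all of
  \<open>cyl u\<close>.\<close>

lemma thin_fibre_DC1_point:
  assumes "fibre \<omega> = {x}"
  shows "DC1_point {0..1} f x"
  unfolding DC1_point_def
proof (intro conjI allI impI)
  show "x \<in> {0..1}" using assms fibre_subset[of \<omega>] J(2) by auto
  fix e :: real assume "e > 0"
  then obtain m where m: "cyl (pre \<omega> m) \<subseteq> ball x e"
    using fibre_shrinks[of \<omega> "ball x e"] assms by auto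
  define u where "u = pre \<omega> m"
  interpret sub: horseshoe f "N * Suc (length u)" "\<lambda>a. cyl (u @ a # u)" "cyl u"
    by (rule subhorseshoe)
  obtain S a where S: "uncountable S" "S \<subseteq> cyl (u @ a # u)" "DC1_scrambled {0..1} f S"
    by (rule sub.uncountable_scrambled_set)
  let ?A = "cyl (u @ a # u)"
  have "closedin (top_of_set {0..1}) ?A"
    using sub.I sub.J by (intro closed_subset) (auto simp: segment_def intro: compact_imp_closed)
  moreover have "(f ^^ (N * Suc (length u))) ` ?A = cyl u" by (rule sub.onto)
  moreover have "cyl u \<subseteq> ball x e \<inter> {0..1}" using m sub.J by (auto simp: u_def)
  ultimately show "\<exists>S n A. uncountable S \<and> DC1_scrambled {0..1} f S \<and> 0 < n \<and>
        closedin (top_of_set {0..1}) A \<and> S \<subseteq> A \<and>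
        A \<subseteq> (f ^^ n) ` A \<and> (f ^^ n) ` A \<subseteq> ball x e \<inter> {0..1}"
    using S sub.N_pos sub.I(2) by (intro exI[of _ S] exI[of _ "N * Suc (length u)"] exI[of _ ?A]) simp
qed

text \<open>The digits \<open>a\<close> will be fixed so as to avoid nondegenerate fibres; the
  digits \<open>b\<close> stay free and parametrize a Cantor set.\<close>

definition interleave :: "(nat \<Rightarrow> bool) \<Rightarrow> (nat \<Rightarrow> bool) \<Rightarrow> nat \<Rightarrow> bool" where
  "interleave a b i = (if even i then a (i div 2) else b (i div 2))"

lemma interleave_nth [simp]: "interleave a b (2 * i) = a i" "interleave a b (Suc (2 * i)) = b i"
  by (simp_all add: interleave_def)

text \<open>
  The sets \<open>{interleave a b | b}\<close> are disjoint for different \<open>a\<close>, and only countably many \<open>\<omega>\<close>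
  have a nondegenerate fibre.
\<close>

lemma thin_slice:
  obtains a p where "\<And>b. fibre (interleave a b) = {p b}"
proof -
  let ?fat = "{\<omega>. \<exists>x\<in>fibre \<omega>. \<exists>y\<in>fibre \<omega>. x \<noteq> y}"
  have "countable ((\<lambda>\<omega> i. \<omega> (2 * i)) ` ?fat)"
    using countable_fat_fibres by (rule countable_image)
  then have "(\<lambda>\<omega> i. \<omega> (2 * i)) ` ?fat \<noteq> UNIV"
    using uncountable_UNIV_bool_seq by metis
  then obtain a where a: "a \<notin> (\<lambda>\<omega> i. \<omega> (2 * i)) ` ?fat"
    by blast
  have "\<exists>x. fibre (interleave a b) = {x}" for b
  proof -
    have "interleave a b \<notin> ?fat"
    proof
      assume "interleave a b \<in> ?fat"
      then have "(\<lambda>i. interleave a b (2 * i)) \<in> (\<lambda>\<omega> i. \<omega> (2 * i)) ` ?fat" by (rule imageI)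
      then show False using a by simp
    qed
    moreover have "fibre (interleave a b) \<noteq> {}"
      using segment_fibre by (simp add: segment_def)
    ultimately show ?thesis by blast
  qed
  then show thesis using that by metis
qed

text \<open>\<open>range p\<close> is closed as an intersection of finite unions of cylinders, and
  changing a late digit of \<open>b\<close> gives another of its points in any neighbourhood of
  \<open>p b\<close>.\<close>

lemma perfect_set_of_DC1_points:
  "\<exists>D\<subseteq>{0..1}. uncountable D \<and> perfect_set D \<and> (\<forall>x\<in>D. DC1_point {0..1} f x)"
proof -
  obtain a p where p: "\<And>b. fibre (interleave a b) = {p b}"
    using thin_slice by blast
  let ?W = "\<lambda>m b. pre (interleave a b) m"
  have p_cyl: "p b \<in> cyl (?W m b)" for b m
    using p[of b] fibre_D by auto
  have inj_p: "p b \<noteq> p b'" if ne: "b \<noteq> b'" for b b'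
  proof -
    obtain i where "b i \<noteq> b' i" using ne unfolding fun_eq_iff by blast
    then have "interleave a b (Suc (2 * i)) \<noteq> interleave a b' (Suc (2 * i))" by simp
    then have "interleave a b \<noteq> interleave a b'" by metis
    from fibre_disjoint[OF this] show ?thesis using p by auto
  qed
  have range_eq: "range p = (\<Inter>m. \<Union>b. cyl (?W m b))"
  proof
    show "range p \<subseteq> (\<Inter>m. \<Union>b. cyl (?W m b))" using p_cyl by blast
    show "(\<Inter>m. \<Union>b. cyl (?W m b)) \<subseteq> range p"
    proof
      fix x assume "x \<in> (\<Inter>m. \<Union>b. cyl (?W m b))"
      then have "\<forall>m. \<exists>b. x \<in> cyl (?W m b)" by auto
      then obtain c where c: "\<And>m. x \<in> cyl (?W m (c m))" by metis
      \<comment> \<open>The sequence \<open>c m\<close> may vary with \<open>m\<close>, but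
        \<open>x\<close> determines the prefixes.\<close>
      have agree: "interleave a (c m) i = interleave a (c n) i" if "i < m" "i < n" for i m n
      proof -
        have "x \<in> cyl (?W (Suc i) (c m))" "x \<in> cyl (?W (Suc i) (c n))"
          using c cyl_pre_mono that by (meson Suc_leI subsetD)+
        then have "?W (Suc i) (c m) = ?W (Suc i) (c n)"
          by (intro cyl_same_length[of _ _ x]) auto
        then show ?thesis by simp
      qed
      \<comment> \<open>Digit \<open>i\<close> of \<open>b\<close> has position
        \<open>2 * i + 1\<close>, so the prefix of length \<open>2 * i + 2\<close> is the first to
        show it.\<close>
      define b where "b i = c (Suc (Suc (2 * i))) i" for i
      have "interleave a (c m) i = interleave a b i" if "i < m" for i m
      proof (cases "even i")
        case True
        then show ?thesis by (simp add: interleave_def)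
      next
        case False
        then obtain l where l: "i = Suc (2 * l)" using oddE by fastforce
        show ?thesis
          using agree[OF that, of "Suc i"] by (simp add: l b_def)
      qed
      then have "?W m (c m) = ?W m b" for m by (intro map_cong) auto
      then have "x \<in> fibre (interleave a b)" using c unfolding fibre_def by (metis INT_I)
      then show "x \<in> range p" using p by auto
    qed
  qed
  have "closed (\<Union>b. cyl (?W m b))" for m
  proof -
    have "finite (range (?W m))"
      by (rule finite_subset[OF _ finite_lists_length_eq[of "UNIV :: bool set" m]]) auto
    moreover have "closed (cyl u)" for u
      using segment_cyl[of u] by (simp add: segment_def compact_imp_closed)
    ultimately have "closed (\<Union>(cyl ` range (?W m)))"
      by (intro closed_Union) auto
    then show ?thesis by (simp only: image_image)
  qed
  then have "closed (range p)"
    unfolding range_eq by (intro closed_INT) auto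
  moreover have "\<not> x isolated_in range p" if x: "x \<in> range p" for x
  proof
    assume "x isolated_in range p"
    then obtain U where U: "open U" "U \<inter> range p = {x}" by (auto simp: isolated_in_def)
    obtain b where b: "x = p b" using x by auto
    have "fibre (interleave a b) \<subseteq> U" using U(2) b p by auto
    then obtain m where m: "cyl (?W m b) \<subseteq> U" using fibre_shrinks U(1) by metis
    \<comment> \<open>Digit \<open>m\<close> of \<open>b\<close> has position
      \<open>2 * m + 1\<close>, beyond the first \<open>m\<close> letters.\<close>
    define b' where "b' = b(m := \<not> b m)"
    have eq: "?W m b' = ?W m b"
      by (rule map_cong) (auto simp: b'_def interleave_def)
    have "p b' \<in> U" using p_cyl[of b' m] m unfolding eq by blast
    moreover have "b' \<noteq> b" unfolding b'_def by (metis fun_upd_same)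
    then have "p b' \<noteq> x" using inj_p b by blast
    ultimately show False using U(2) by auto
  qed
  ultimately have "perfect_set (range p)" by (simp add: perfect_set_def)
  moreover have "uncountable (range p)"
    using uncountable_UNIV_bool_seq countable_image_inj_on inj_p by (metis injI)
  moreover have "DC1_point {0..1} f x" if "x \<in> range p" for x
    using that thin_fibre_DC1_point[OF p] by blast
  moreover have "range p \<subseteq> {0..1}"
    using p fibre_subset J(2) by (metis image_subsetI insert_subset subset_trans)
  ultimately show ?thesis by blast
qed

end

theorem theorem1:
  fixes f :: "real \<Rightarrow> real"
  assumes "continuous_on {0..1} f"
    and "f ` {0..1} \<subseteq> {0..1}"
    and "topological_entropy (top_of_set {0..1}) f > 0"
  shows "(\<exists>D\<subseteq>{0..1}. uncountable D \<and> (\<forall>x\<in>D. DC1_point {0..1} f x)) \<and>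
    (\<exists>D\<subseteq>{0..1}. uncountable D \<and> perfect_set D \<and> (\<forall>x\<in>D. DC1_point {0..1} f x))"
proof -
  obtain N J A B where h: "0 < N" "segment J" "J \<subseteq> {0..1}" "segment A" "segment B" "A \<subseteq> J" "B \<subseteq> J"
    "A \<inter> B = {}" "(f ^^ N) ` A = J" "(f ^^ N) ` B = J"
    by (rule positive_entropy_imp_horseshoe[OF assms])
  interpret horseshoe f N "\<lambda>a. if a then B else A" J
    using assms h by unfold_locales auto
  obtain D where "D \<subseteq> {0..1}" "uncountable D" "perfect_set D" "\<forall>x\<in>D. DC1_point {0..1} f x"
    using perfect_set_of_DC1_points by (elim exE conjE)
  then show ?thesis by (intro conjI exI[of _ D])
qed

end
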